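(* Let $T$ be a complete first-order theory with monster model $\mathcal U$ and let $\phi(x,y)$ be an NIP formula. Then there exists a formula $\psi(x,z)$ (without parameters) such that if $A\subseteq\mathcal U^x$ is a (small) set with $|A|>1$ and $b\in\mathcal U^y$, then $\psi(x,z)$ is an honest definition of $\mathrm{tp}_{\phi^{\mathrm{opp}}}(b/A)$, i.e.: for every finite $A_0\subseteq A$ there is $c\in A^z$ such that $$\phi(A_0,b)\subseteq\psi(A,c)\subseteq\phi(A,b).$$ Namely, one may take $$\psi(x,(\bar z,\bar z',\bar z'')):=\operatorname{Maj}_{i<n}\ \forall y\Big(\bigwedge_{j<k}\big(\phi(z_{i,j},y)\leftrightarrow(z'_{i,j}=z''_{i,j})\big)\rightarrow\phi(x,y)\Big),$$ where $\bar z=(z_{i,j})_{i<n,j<k}$, and similarly $\bar z',\bar z''$, consist of variables of the sort of $x$, and where, with $d=\mathrm{vc}(\phi)$, $n:=\min\{m\in\mathbb N:\tfrac12m>2^{d+1}-1\}$ and $k:=k_{\mathrm{sd}}(N_{\mathrm{pq}}(n,2^{d+1}),d)$.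
   Context: $\mathcal U$ is a large saturated model of $T$; small means of cardinality $<|\mathcal U|$. $\phi(x,y)$ is NIP if the family $\{\phi(\mathcal U^x,b):b\in\mathcal U^y\}$ of subsets of $\mathcal U^x$ has finite VC-dimension, denoted $\mathrm{vc}(\phi)$. For $A\subseteq\mathcal U^x$, $\phi(A,b)=\{a\in A:\mathcal U\vDash\phi(a,b)\}$, and $\mathrm{tp}_{\phi^{\mathrm{opp}}}(b/A)$ is the set of formulas $\phi(a,y)$, $\neg\phi(a,y)$ ($a\in A$) true of $b$. In an honest definition $\psi(x,z)$, $z$ is a tuple of variables each of the same sort as $x$ and $A^z$ is the set of corresponding tuples of elements of $A$. $\operatorname{Maj}_{i<n}P_i$ is the Boolean combination $\bigvee_{I\subseteq n,|I|>n/2}\bigwedge_{i\in I}P_i$. Functions: $k_{\mathrm{comp}}(d)=2^{d+1}(d-2)+d+4$; $\binom{s}{\leq k}=\sum_{i\leq k}\binom si$; $B_{\mathrm{vc}}(n,k)=\max\{s\in\mathbb N:\binom{s}{\leq k}^n\geq 2^s\}$; $k_{\mathrm{sd}}(1,d)=k_{\mathrm{comp}}(d)+2d+2$ and $k_{\mathrm{sd}}(n,d)=n\cdot k_{\mathrm{sd}}(1,2^{B_{\mathrm{vc}}(n,2^{d+1})+1})$ for $n\neq1$. $N_{\mathrm{pq}}:\mathbb N^2\to\mathbb N$ is a fixed function as provided by the (known) $(p,q)$-theorem of Alon–Kleitman and Matoušek: for all $q\leq p<\omega$, if $(X,\mathcal F)$ is a finite set system of non-empty sets whose dual family $\{\{s\in\mathcal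 F:x\in s\}:x\in X\}$ has VC-dimension $<q$, and such that every $S\subseteq\mathcal F$ with $|S|\geq p$ contains $S_0\subseteq S$ with $|S_0|\geq q$ and $\bigcap S_0\neq\emptyset$, then there is $X_0\subseteq X$ with $|X_0|\leq N_{\mathrm{pq}}(p,q)$ meeting every $s\in\mathcal F$. *)

theory Defs
  imports Complex_Main "HOL-Library.Equipollence" "HOL-Library.Extended_Nat"
begin

record ('f, 'r, 's) language =
  funs :: "'f set"
  rels :: "'r set"
  fdom :: "'f \<Rightarrow> 's list"
  fcod :: "'f \<Rightarrow> 's"
  rdom :: "'r \<Rightarrow> 's list"

type_synonym 's var = "'s \<times> nat"

abbreviation sort_of :: "'s var \<Rightarrow> 's" where "sort_of \<equiv> fst"

datatype ('f, tm_vars: 'v) tm = Var 'v | Fn 'f "('f, 'v) tm list"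

text \<open>The set function \<open>vars\<close> collects all occurring variables, bound ones included;
  \<open>fv\<close> below collects the free ones.\<close>

datatype ('f, 'r, vars: 'v) fm =
    Tru
  | Eq "('f, 'v) tm" "('f, 'v) tm"
  | Rel 'r "('f, 'v) tm list"
  | Neg "('f, 'r, 'v) fm"
  | And "('f, 'r, 'v) fm" "('f, 'r, 'v) fm"
  | All 'v "('f, 'r, 'v) fm"

abbreviation "Or p q \<equiv> Neg (And (Neg p) (Neg q))"
abbreviation "Imp p q \<equiv> Neg (And p (Neg q))"
abbreviation "Iff p q \<equiv> And (Imp p q) (Imp q p)"

definition Conj :: "('f, 'r, 'v) fm list \<Rightarrow> ('f, 'r, 'v) fm" where
  "Conj ps = foldr And ps Tru"

definition Disj :: "('f, 'r, 'v) fm list \<Rightarrow> ('f, 'r, 'v) fm" where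
  "Disj ps = foldr Or ps (Neg Tru)"

definition Alls :: "'v list \<Rightarrow> ('f, 'r, 'v) fm \<Rightarrow> ('f, 'r, 'v) fm" where
  "Alls vs p = foldr All vs p"

definition Eqs :: "'v list \<Rightarrow> 'v list \<Rightarrow> ('f, 'r, 'v) fm" where
  "Eqs vs ws = Conj (map2 (\<lambda>v w. Eq (Var v) (Var w)) vs ws)"

text \<open>\<^term>\<open>subseqs ps\<close> selects by position, so it runs through the sets \<open>I\<close> of indices.\<close>

definition Maj :: "('f, 'r, 'v) fm list \<Rightarrow> ('f, 'r, 'v) fm" where
  "Maj ps = Disj (map Conj (filter (\<lambda>qs. real (length qs) > real (length ps) / 2) (subseqs ps)))"

primrec fv :: "('f, 'r, 'v) fm \<Rightarrow> 'v set" where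
  "fv Tru = {}"
| "fv (Eq t u) = tm_vars t \<union> tm_vars u"
| "fv (Rel r ts) = (\<Union>t\<in>set ts. tm_vars t)"
| "fv (Neg p) = fv p"
| "fv (And p q) = fv p \<union> fv q"
| "fv (All v p) = fv p - {v}"

text \<open>Substitution of variables for free variables. It does not rename bound variables, so it is
  only used with target variables that do not occur in the formula.\<close>

primrec subst :: "('f, 'r, 'v) fm \<Rightarrow> ('v \<Rightarrow> 'v) \<Rightarrow> ('f, 'r, 'v) fm" where
  "subst Tru s = Tru"
| "subst (Eq t u) s = Eq (map_tm id s t) (map_tm id s u)"
| "subst (Rel r ts) s = Rel r (map (map_tm id s) ts)"
| "subst (Neg p) s = Neg (subst p s)"
| "subst (And p q) s = And (subst p s) (subst q s)"
| "subst (All v p) s = All v (subst p (s(v := v)))"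

definition replace :: "'v list \<Rightarrow> 'v list \<Rightarrow> 'v \<Rightarrow> 'v" where
  "replace vs ws v = (case map_of (zip vs ws) v of Some w \<Rightarrow> w | None \<Rightarrow> v)"

fun has_sort :: "('f, 'r, 's) language \<Rightarrow> ('f, 's var) tm \<Rightarrow> 's \<Rightarrow> bool" where
  "has_sort L (Var v) s \<longleftrightarrow> sort_of v = s"
| "has_sort L (Fn f ts) s \<longleftrightarrow>
     f \<in> funs L \<and> fcod L f = s \<and> list_all2 (\<lambda>t s. has_sort L t s) ts (fdom L f)"

primrec wff :: "('f, 'r, 's) language \<Rightarrow> ('f, 'r, 's var) fm \<Rightarrow> bool" where
  "wff L Tru \<longleftrightarrow> True"
| "wff L (Eq t u) \<longleftrightarrow> (\<exists>s. has_sort L t s \<and> has_sort L u s)"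
| "wff L (Rel r ts) \<longleftrightarrow> r \<in> rels L \<and> list_all2 (has_sort L) ts (rdom L r)"
| "wff L (Neg p) \<longleftrightarrow> wff L p"
| "wff L (And p q) \<longleftrightarrow> wff L p \<and> wff L q"
| "wff L (All v p) \<longleftrightarrow> wff L p"

definition sentence :: "('f, 'r, 's) language \<Rightarrow> ('f, 'r, 's var) fm \<Rightarrow> bool" where
  "sentence L p \<longleftrightarrow> wff L p \<and> fv p = {}"

text \<open>\<open>p(vs)\<close>: a formula of the language, without parameters, in the tuple \<open>vs\<close> of variables.\<close>

definition formula_in ::
  "('f, 'r, 's) language \<Rightarrow> ('f, 'r, 's var) fm \<Rightarrow> 's var list \<Rightarrow> bool" where
  "formula_in L p vs \<longleftrightarrow> wff L p \<and> distinct vs \<and> fv p \<subseteq> set vs"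

record ('f, 'r, 's, 'u) struct =
  univ :: "'s \<Rightarrow> 'u set"
  fint :: "'f \<Rightarrow> 'u list \<Rightarrow> 'u"
  rint :: "'r \<Rightarrow> 'u list set"

definition is_struct :: "('f, 'r, 's) language \<Rightarrow> ('f, 'r, 's, 'u) struct \<Rightarrow> bool" where
  "is_struct L M \<longleftrightarrow>
     (\<forall>s. univ M s \<noteq> {}) \<and>
     (\<forall>f\<in>funs L. \<forall>as. list_all2 (\<lambda>a s. a \<in> univ M s) as (fdom L f)
        \<longrightarrow> fint M f as \<in> univ M (fcod L f))"

primrec eval_tm :: "('f, 'r, 's, 'u) struct \<Rightarrow> ('s var \<Rightarrow> 'u) \<Rightarrow> ('f, 's var) tm \<Rightarrow> 'u" where
  "eval_tm M e (Var v) = e v"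
| "eval_tm M e (Fn f ts) = fint M f (map (eval_tm M e) ts)"

primrec sat :: "('f, 'r, 's, 'u) struct \<Rightarrow> ('s var \<Rightarrow> 'u) \<Rightarrow> ('f, 'r, 's var) fm \<Rightarrow> bool" where
  "sat M e Tru \<longleftrightarrow> True"
| "sat M e (Eq t u) \<longleftrightarrow> eval_tm M e t = eval_tm M e u"
| "sat M e (Rel r ts) \<longleftrightarrow> map (eval_tm M e) ts \<in> rint M r"
| "sat M e (Neg p) \<longleftrightarrow> \<not> sat M e p"
| "sat M e (And p q) \<longleftrightarrow> sat M e p \<and> sat M e q"
| "sat M e (All v p) \<longleftrightarrow> (\<forall>a\<in>univ M (sort_of v). sat M (e(v := a)) p)"

text \<open>\<open>M \<Turnstile> p(as)\<close>, where \<open>as\<close> is substituted for the tuple \<open>vs\<close>; meant for formulas in \<open>vs\<close>,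
  so the default value of the assignment is irrelevant.\<close>

definition holds ::
  "('f, 'r, 's, 'u) struct \<Rightarrow> ('f, 'r, 's var) fm \<Rightarrow> 's var list \<Rightarrow> 'u list \<Rightarrow> bool" where
  "holds M p vs as \<longleftrightarrow>
     sat M (\<lambda>v. case map_of (zip vs as) v of Some a \<Rightarrow> a | None \<Rightarrow> undefined) p"

definition models ::
  "('f, 'r, 's) language \<Rightarrow> ('f, 'r, 's, 'u) struct \<Rightarrow> ('f, 'r, 's var) fm set \<Rightarrow> bool" where
  "models L M T \<longleftrightarrow> is_struct L M \<and> (\<forall>p\<in>T. \<forall>e. sat M e p)"

text \<open>Satisfiability and semantic consequence are tested on models with elements in the type of
  formulas. This type is infinite and at least as large as the language, so by the
  Loewenheim--Skolem theorem this is the same as testing on all models.\<close>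

definition satisfiable :: "('f, 'r, 's) language \<Rightarrow> ('f, 'r, 's var) fm set \<Rightarrow> bool" where
  "satisfiable L T \<longleftrightarrow> (\<exists>M :: ('f, 'r, 's, ('f, 'r, 's var) fm) struct. models L M T)"

definition entails ::
  "('f, 'r, 's) language \<Rightarrow> ('f, 'r, 's var) fm set \<Rightarrow> ('f, 'r, 's var) fm \<Rightarrow> bool" where
  "entails L T p \<longleftrightarrow>
     (\<forall>M :: ('f, 'r, 's, ('f, 'r, 's var) fm) struct. models L M T \<longrightarrow> (\<forall>e. sat M e p))"

definition complete_theory ::
  "('f, 'r, 's) language \<Rightarrow> ('f, 'r, 's var) fm set \<Rightarrow> bool" where
  "complete_theory L T \<longleftrightarrow>
     (\<forall>p\<in>T. sentence L p) \<and> satisfiable L T \<and>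
     (\<forall>p. sentence L p \<longrightarrow> entails L T p \<or> entails L T (Neg p))"

text \<open>The sorts of a structure need not be disjoint subsets of the type, so the set of its elements
  is the disjoint union of the sorts.\<close>

definition elems :: "('f, 'r, 's, 'u) struct \<Rightarrow> ('s \<times> 'u) set" where
  "elems M = (SIGMA s:UNIV. univ M s)"

definition small :: "('f, 'r, 's, 'u) struct \<Rightarrow> 'a set \<Rightarrow> bool" where
  "small M A \<longleftrightarrow> A \<prec> elems M"

text \<open>A formula in the variable \<open>v\<close> with parameters in \<open>B\<close> is a pair of a formula and an assignment
  giving its free variables other than \<open>v\<close> values in \<open>B\<close>.\<close>

definition saturated :: "('f, 'r, 's) language \<Rightarrow> ('f, 'r, 's, 'u) struct \<Rightarrow> bool" where
  "saturated L M \<longleftrightarrow>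
     (\<forall>B v \<Sigma>. B \<subseteq> elems M \<and> small M B \<and>
        (\<forall>(p, e)\<in>\<Sigma>. wff L p \<and> (\<forall>w\<in>fv p - {v}. (sort_of w, e w) \<in> B)) \<and>
        (\<forall>\<Sigma>'. \<Sigma>' \<subseteq> \<Sigma> \<and> finite \<Sigma>' \<longrightarrow>
           (\<exists>a\<in>univ M (sort_of v). \<forall>(p, e)\<in>\<Sigma>'. sat M (e(v := a)) p))
        \<longrightarrow> (\<exists>a\<in>univ M (sort_of v). \<forall>(p, e)\<in>\<Sigma>. sat M (e(v := a)) p))"

text \<open>No lower bound on the cardinality of the model is imposed beyond saturation.\<close>

definition monster_model ::
  "('f, 'r, 's) language \<Rightarrow> ('f, 'r, 's var) fm set \<Rightarrow> ('f, 'r, 's, 'u) struct \<Rightarrow> bool" where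
  "monster_model L T M \<longleftrightarrow> models L M T \<and> saturated L M"

definition shatters :: "'a set set \<Rightarrow> 'a set \<Rightarrow> bool" where
  "shatters \<F> S \<longleftrightarrow> (\<lambda>F. F \<inter> S) ` \<F> = Pow S"

definition vc_dim :: "'a set \<Rightarrow> 'a set set \<Rightarrow> enat" where
  "vc_dim X \<F> = (SUP S\<in>{S. S \<subseteq> X \<and> finite S \<and> shatters \<F> S}. enat (card S))"

text \<open>\<open>M\<^sup>x\<close>\<close>

definition tuples :: "('f, 'r, 's, 'u) struct \<Rightarrow> 's var list \<Rightarrow> 'u list set" where
  "tuples M x = {a. list_all2 (\<lambda>c v. c \<in> univ M (sort_of v)) a x}"

text \<open>\<open>\<phi>(A, b)\<close>, with the variables \<open>x\<close> for elements of \<open>A\<close> and \<open>y\<close> for \<open>b\<close>\<close>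

definition trace ::
  "('f, 'r, 's, 'u) struct \<Rightarrow> ('f, 'r, 's var) fm \<Rightarrow> 's var list \<Rightarrow> 's var list
   \<Rightarrow> 'u list set \<Rightarrow> 'u list \<Rightarrow> 'u list set" where
  "trace M \<phi> x y A b = {a\<in>A. holds M \<phi> (x @ y) (a @ b)}"

definition vc ::
  "('f, 'r, 's, 'u) struct \<Rightarrow> ('f, 'r, 's var) fm \<Rightarrow> 's var list \<Rightarrow> 's var list \<Rightarrow> enat" where
  "vc M \<phi> x y = vc_dim (tuples M x) ((\<lambda>b. trace M \<phi> x y (tuples M x) b) ` tuples M y)"

definition NIP ::
  "('f, 'r, 's, 'u) struct \<Rightarrow> ('f, 'r, 's var) fm \<Rightarrow> 's var list \<Rightarrow> 's var list \<Rightarrow> bool" where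
  "NIP M \<phi> x y \<longleftrightarrow> vc M \<phi> x y < \<infinity>"

text \<open>The variables \<open>z\<close> of an honest definition \<open>\<psi>(x, z)\<close> are a list of tuples of variables, each of
  the same sort(s) as the tuple \<open>x\<close>; an element of \<open>A\<^sup>z\<close> is a list of as many elements of \<open>A\<close>.\<close>

definition sorted_like :: "'s var list \<Rightarrow> 's var list list \<Rightarrow> bool" where
  "sorted_like x z \<longleftrightarrow> (\<forall>w\<in>set z. map sort_of w = map sort_of x)"

text \<open>\<open>\<psi>(x, z)\<close> is an honest definition of \<open>tp\<^bsub>\<phi>opp\<^esub>(b/A)\<close>. The type is determined by
  \<open>\<phi>(A, b)\<close>, so \<open>A\<close> and \<open>b\<close> are given in its place.\<close>

definition honest_definition ::
  "('f, 'r, 's, 'u) struct \<Rightarrow> ('f, 'r, 's var) fm \<Rightarrow> 's var list \<Rightarrow> 's var list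
   \<Rightarrow> 'u list set \<Rightarrow> 'u list \<Rightarrow> ('f, 'r, 's var) fm \<Rightarrow> 's var list list \<Rightarrow> bool" where
  "honest_definition M \<phi> x y A b \<psi> z \<longleftrightarrow>
     (\<forall>A\<^sub>0. A\<^sub>0 \<subseteq> A \<and> finite A\<^sub>0 \<longrightarrow>
        (\<exists>c. length c = length z \<and> set c \<subseteq> A \<and>
           trace M \<phi> x y A\<^sub>0 b \<subseteq> trace M \<psi> x (concat z) A (concat c) \<and>
           trace M \<psi> x (concat z) A (concat c) \<subseteq> trace M \<phi> x y A b))"

definition uniform_honest_definition ::
  "('f, 'r, 's) language \<Rightarrow> ('f, 'r, 's, 'u) struct \<Rightarrow> ('f, 'r, 's var) fm
   \<Rightarrow> 's var list \<Rightarrow> 's var list \<Rightarrow> ('f, 'r, 's var) fm \<Rightarrow> 's var list list \<Rightarrow> bool" where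
  "uniform_honest_definition L M \<phi> x y \<psi> z \<longleftrightarrow>
     sorted_like x z \<and> formula_in L \<psi> (x @ concat z) \<and>
     (\<forall>A b. A \<subseteq> tuples M x \<and> small M A \<and> (\<exists>a\<in>A. \<exists>a'\<in>A. a \<noteq> a') \<and> b \<in> tuples M y
        \<longrightarrow> honest_definition M \<phi> x y A b \<psi> z)"

definition blocks :: "nat \<Rightarrow> nat \<Rightarrow> (nat \<Rightarrow> nat \<Rightarrow> 'a) \<Rightarrow> 'a list" where
  "blocks n k z = concat (map (\<lambda>i. map (\<lambda>j. z i j) [0..<k]) [0..<n])"

definition maj_formula ::
  "nat \<Rightarrow> nat \<Rightarrow> ('f, 'r, 'v) fm \<Rightarrow> 'v list \<Rightarrow> 'v list
   \<Rightarrow> (nat \<Rightarrow> nat \<Rightarrow> 'v list) \<Rightarrow> (nat \<Rightarrow> nat \<Rightarrow> 'v list) \<Rightarrow> (nat \<Rightarrow> nat \<Rightarrow> 'v list)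
   \<Rightarrow> ('f, 'r, 'v) fm" where
  "maj_formula n k \<phi> x y z z' z'' =
     Maj (map (\<lambda>i.
       Alls y (Imp
         (Conj (map (\<lambda>j. Iff (subst \<phi> (replace x (z i j))) (Eqs (z' i j) (z'' i j))) [0..<k]))
         \<phi>)) [0..<n])"

text \<open>The subtraction in \<open>k_comp\<close> must not be truncated; the total is nonnegative for every \<open>d\<close>.\<close>

definition k_comp :: "nat \<Rightarrow> nat" where
  "k_comp d = nat (2 ^ (d + 1) * (int d - 2) + int d + 4)"

definition choose_upto :: "nat \<Rightarrow> nat \<Rightarrow> nat" where
  "choose_upto s k = (\<Sum>i\<le>k. s choose i)"

definition B_vc :: "nat \<Rightarrow> nat \<Rightarrow> nat" where
  "B_vc n k = Max {s. choose_upto s k ^ n \<ge> 2 ^ s}"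

definition k_sd_one :: "nat \<Rightarrow> nat" where
  "k_sd_one d = k_comp d + 2 * d + 2"

definition k_sd :: "nat \<Rightarrow> nat \<Rightarrow> nat" where
  "k_sd n d = (if n = 1 then k_sd_one d else n * k_sd_one (2 ^ (B_vc n (2 ^ (d + 1)) + 1)))"

text \<open>\<open>N\<close> is a function as provided by the \<open>(p,q)\<close>-theorem. Every finite set system is isomorphic to
  one on a finite set of natural numbers.\<close>

definition pq_function :: "(nat \<Rightarrow> nat \<Rightarrow> nat) \<Rightarrow> bool" where
  "pq_function N \<longleftrightarrow>
     (\<forall>p q (X :: nat set) \<F>.
        q \<le> p \<and> finite X \<and> \<F> \<subseteq> Pow X \<and> {} \<notin> \<F> \<and>
        vc_dim \<F> ((\<lambda>x. {s\<in>\<F>. x \<in> s}) ` X) < enat q \<and>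
        (\<forall>S\<subseteq>\<F>. card S \<ge> p \<longrightarrow>
           (\<exists>S\<^sub>0\<subseteq>S. card S\<^sub>0 \<ge> q \<and> (\<exists>x\<in>X. \<forall>s\<in>S\<^sub>0. x \<in> s)))
        \<longrightarrow> (\<exists>X\<^sub>0\<subseteq>X. card X\<^sub>0 \<le> N p q \<and> (\<forall>s\<in>\<F>. X\<^sub>0 \<inter> s \<noteq> {})))"

end

theory Submission imports Defs "HOL-Library.Sublist"
begin

text \<open>Fix \<open>b\<close>, and call a \<open>\<phi>\<close>-type \<open>p\<close> over \<open>A\<close> compressible if, for every finite \<open>A\<^sub>0 \<subseteq> A\<close>, boundedly many
  values of \<open>p\<close> imply \<open>p\<close> on \<open>A\<^sub>0\<close>. If some \<open>n\<close> compressible types have no point of \<open>A\<close> at which a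
  majority of them differs from \<open>b\<close>, then the few values that decide \<open>A\<^sub>0\<close> for each of them are the
  parameters of the honest definition. Otherwise the disagreement sets with \<open>b\<close> have the
  \<open>(p,q)\<close>-property, so any finite number of them has a transversal of size \<open>N\<close>, and by compactness
  there is an ultrafilter on \<open>N\<close>-subsets of \<open>A\<close> such that every compressible type differs from \<open>b\<close>
  somewhere on almost every such subset. But there is a compressible type that agrees with \<open>b\<close> on almost
  every subset: otherwise one builds a long sequence of \<open>N\<close>-subsets on which agreement and
  disagreement with \<open>b\<close> can be prescribed independently, against the Sauer--Shelah bound.\<close>

section \<open>Minimal filters and ultrafilters\<close>

text \<open>As \<open>A\<close> may be infinite, there need be no smallest nonempty class of types
  cut out by boundedly many values. Closed sets of types are therefore carried as filters on the
  parameters: Zorn's lemma supplies minimal ones, and finite conjunctions of eventual statements do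
  the work of compactness. The constants have three sources. \<open>k_comp d\<close> is the price of
  one compressible type, with one summand for each lowering of the VC-dimension. The number
  \<open>q = 2 ^ (d + 1)\<close> exceeds the dual VC-dimension of the disagreement sets, and
  \<open>n = 2 * q - 1\<close> makes fewer than \<open>q\<close> errors a minority. The other term
  that \<open>k\<close> must accommodate is \<open>N * M\<close>: a type close to \<open>b\<close>
  becomes compressible only after its values on \<open>M\<close> subsets of size at most
  \<open>N\<close> are fixed, and the Sauer--Shelah count asks for
  \<open>(N * M + 1) ^ d < 2 ^ M\<close>. The \<open>B_vc\<close> inside \<open>k_sd\<close>
  provides such an \<open>M\<close>. The truth values of a type cannot be written into a formula
  without parameters; the equalities between \<open>z'\<close> and \<open>z''\<close> read them off
  from two distinct elements of \<open>A\<close>.\<close>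

lemma ex_minimal_filter:
  fixes S :: "'b filter set"
  assumes "F \<in> S"
    and chain: "\<And>C. C \<subseteq> S \<Longrightarrow> C \<noteq> {} \<Longrightarrow> (\<And>G H. G \<in> C \<Longrightarrow> H \<in> C \<Longrightarrow> G \<le> H \<or> H \<le> G) \<Longrightarrow> Inf C \<in> S"
  obtains M where "M \<in> S" "M \<le> F" "\<And>G. G \<in> S \<Longrightarrow> G \<le> M \<Longrightarrow> G = M"
proof -
  let ?A = "{G\<in>S. G \<le> F}"
  \<comment> \<open>\<open>predicate_Zorn\<close> produces maximal elements, hence the reversed
    order, in which an infimum bounds a chain.\<close>
  have po: "partial_order_on ?A (relation_of (\<lambda>a b. b \<le> a) ?A)"
    by (rule partial_order_on_relation_ofI) auto
  have "\<exists>m\<in>?A. \<forall>a\<in>?A. a \<le> m \<longrightarrow> a = m"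
  proof (rule predicate_Zorn[OF po])
    fix C assume C: "C \<in> Chains (relation_of (\<lambda>a b. b \<le> a) ?A)"
    have sub: "C \<subseteq> ?A" and lin: "\<And>G H. G \<in> C \<Longrightarrow> H \<in> C \<Longrightarrow> G \<le> H \<or> H \<le> G"
      using C unfolding Chains_def relation_of_def by blast+
    show "\<exists>u\<in>?A. \<forall>a\<in>C. u \<le> a"
    proof (cases "C = {}")
      case True
      then show ?thesis using assms(1) by blast
    next
      case False
      have "Inf C \<in> S" by (rule chain) (use sub lin False in auto)
      moreover have "Inf C \<le> F"
        using False sub by (metis (no_types, lifting) Inf_lower2 ex_in_conv mem_Collect_eq subsetD)
      ultimately show ?thesis by (auto intro: Inf_lower)
    qed
  qed
  then show ?thesis using that by (blast intro: order_trans)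
qed

text \<open>A chain is downward directed, hence a base of its infimum: what holds eventually there
  is witnessed by one member. Nontriviality and \<open>based\<close> pass to infima of chains in
  this way.\<close>

lemma eventually_Inf_chain:
  assumes "C \<noteq> {}" and "\<And>G H. G \<in> C \<Longrightarrow> H \<in> C \<Longrightarrow> G \<le> H \<or> H \<le> G"
  shows "eventually P (Inf C) \<longleftrightarrow> (\<exists>G\<in>C. eventually P G)"
proof (rule eventually_Inf_base[OF assms(1)])
  fix G H assume GH: "G \<in> C" "H \<in> C"
  then show "\<exists>x\<in>C. x \<le> inf G H" using assms(2)[OF GH] by auto
qed

lemma Inf_chain_not_bot:
  assumes "C \<noteq> {}" and "\<And>G H. G \<in> C \<Longrightarrow> H \<in> C \<Longrightarrow> G \<le> H \<or> H \<le> G" and "bot \<notin> C"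
  shows "Inf C \<noteq> (bot :: 'b filter)"
  using assms eventually_Inf_chain[OF assms(1,2), where P = "\<lambda>_. False"]
  by (metis trivial_limit_def)

text \<open>A minimal proper filter decides every \<open>P\<close>: restricting it to
  \<open>P\<close> either collapses it, and then \<open>P\<close> fails eventually, or gives it
  back.\<close>

lemma ex_ultrafilter:
  fixes F :: "'b filter"
  assumes "F \<noteq> bot"
  obtains U where "U \<le> F" "U \<noteq> bot" "\<And>P. eventually P U \<or> eventually (\<lambda>x. \<not> P x) U"
proof -
  obtain U where U: "U \<in> {G. G \<noteq> bot}" "U \<le> F" "\<And>G. G \<in> {G. G \<noteq> bot} \<Longrightarrow> G \<le> U \<Longrightarrow> G = U"
  proof (rule ex_minimal_filter[of F "{G. G \<noteq> bot}"])
    show "Inf C \<in> {G. G \<noteq> bot}" if "C \<subseteq> {G. G \<noteq> bot}" "C \<noteq> {}"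
      "\<And>G H. G \<in> C \<Longrightarrow> H \<in> C \<Longrightarrow> G \<le> H \<or> H \<le> G" for C :: "'b filter set"
      using Inf_chain_not_bot[OF that(2,3)] that(1) by auto
  qed (use assms that in auto)
  have "eventually P U \<or> eventually (\<lambda>x. \<not> P x) U" for P
  proof (cases "inf U (principal {x. P x}) = bot")
    case True
    then show ?thesis
      by (auto simp: trivial_limit_def eventually_inf_principal)
  next
    case False
    then have "inf U (principal {x. P x}) = U" by (intro U(3)) auto
    moreover have "eventually P (inf U (principal {x. P x}))"
      by (simp add: eventually_inf_principal)
    ultimately show ?thesis by simp
  qed
  with U show ?thesis using that by blast
qed

section \<open>Compressible types\<close>

text \<open>In the application \<open>r a c\<close> is the truth value of \<phi>(a,c). A type over
  \<open>A\<close> is coded by its truth function \<open>p\<close>, and \<open>c\<close> is a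
  parameter realising \<open>p\<close> on \<open>Y\<close>.\<close>

definition agree :: "('a \<Rightarrow> 'b \<Rightarrow> bool) \<Rightarrow> ('a \<Rightarrow> bool) \<Rightarrow> 'a set \<Rightarrow> 'b \<Rightarrow> bool" where
  "agree r p Y c \<longleftrightarrow> (\<forall>a\<in>Y. r a c = p a)"

lemma agree_Un [simp]: "agree r p (Y \<union> Z) c \<longleftrightarrow> agree r p Y c \<and> agree r p Z c"
  unfolding agree_def by auto

lemma agree_insert [simp]: "agree r p (insert a Y) c \<longleftrightarrow> r a c = p a \<and> agree r p Y c"
  unfolding agree_def by auto

lemma agree_subset: "agree r p Y c \<Longrightarrow> Z \<subseteq> Y \<Longrightarrow> agree r p Z c"
  unfolding agree_def by auto

text \<open>A filter on the parameters \<open>c\<close> stands for the closed set of types consistent with it; the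
  notions below are relative to this closed set.\<close>

definition vc_below :: "('a \<Rightarrow> 'b \<Rightarrow> bool) \<Rightarrow> 'a set \<Rightarrow> nat \<Rightarrow> 'b filter \<Rightarrow> bool" where
  "vc_below r A d F \<longleftrightarrow> (\<forall>Z\<subseteq>A. finite Z \<and> card Z = d \<longrightarrow>
     (\<exists>T\<subseteq>Z. \<forall>\<^sub>F c in F. \<not> agree r (\<lambda>a. a \<in> T) Z c))"

lemma vc_below_mono: "vc_below r A d F \<Longrightarrow> G \<le> F \<Longrightarrow> vc_below r A d G"
  unfolding vc_below_def by (elim all_forward imp_forward ex_forward conj_forward filter_leD)

text \<open>The filter form of "\<open>G\<close> is the part of \<open>F\<close> cut out by at most
  \<open>k\<close> values". The set \<open>Y\<close> may depend on \<open>P\<close>, since over an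
  infinite \<open>A\<close> no single choice need cut out all of \<open>G\<close>.\<close>

definition based :: "('a \<Rightarrow> 'b \<Rightarrow> bool) \<Rightarrow> 'a set \<Rightarrow> nat \<Rightarrow> 'b filter \<Rightarrow> 'b filter \<Rightarrow> bool" where
  "based r A k F G \<longleftrightarrow> (\<forall>P. eventually P G \<longrightarrow> (\<exists>Y s. Y \<subseteq> A \<and> finite Y \<and> card Y \<le> k \<and>
     (\<forall>\<^sub>F c in G. agree r s Y c) \<and> (\<forall>\<^sub>F c in F. agree r s Y c \<longrightarrow> P c)))"

lemma basedE:
  assumes "based r A k F G" "eventually P G"
  obtains Y s where "Y \<subseteq> A" "finite Y" "card Y \<le> k"
    "\<forall>\<^sub>F c in G. agree r s Y c" "\<forall>\<^sub>F c in F. agree r s Y c \<longrightarrow> P c"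
  using assms unfolding based_def by blast

text \<open>The frequency clause makes \<open>p\<close> finitely consistent with \<open>F\<close>;
  otherwise an inconsistent choice of values on \<open>Y\<close> would satisfy the implication
  vacuously.\<close>

definition compressible :: "('a \<Rightarrow> 'b \<Rightarrow> bool) \<Rightarrow> 'a set \<Rightarrow> nat \<Rightarrow> 'b filter \<Rightarrow> ('a \<Rightarrow> bool) \<Rightarrow> bool" where
  "compressible r A k F p \<longleftrightarrow> (\<forall>A\<^sub>0\<subseteq>A. finite A\<^sub>0 \<longrightarrow>
     (\<exists>Y\<subseteq>A. finite Y \<and> card Y \<le> k \<and> (\<forall>\<^sub>F c in F. agree r p Y c \<longrightarrow> agree r p A\<^sub>0 c)) \<and>
     (\<exists>\<^sub>F c in F. agree r p A\<^sub>0 c))"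

lemma compressibleD:
  assumes "compressible r A k F p" "A\<^sub>0 \<subseteq> A" "finite A\<^sub>0"
  shows "\<exists>Y\<subseteq>A. finite Y \<and> card Y \<le> k \<and> (\<forall>\<^sub>F c in F. agree r p Y c \<longrightarrow> agree r p A\<^sub>0 c)"
    and "\<exists>\<^sub>F c in F. agree r p A\<^sub>0 c"
  using assms by (simp_all add: compressible_def)

text \<open>The size \<open>2 ^ Suc d * d + 1\<close> is the least one that forces one of
  \<open>2 ^ Suc d\<close> classes to have \<open>Suc d\<close> elements. If \<open>Y\<close> has
  \<open>j\<close> elements fewer, the class may be smaller by \<open>j\<close>, and averaging still
  finds it. Exchanging this class for \<open>Z\<close> then keeps the number of values within the
  bound.\<close>

lemma pigeonhole_patterns:
  fixes d :: nat
  assumes "finite Y" "finite Z" "card Z = Suc d" "f ` Y \<subseteq> Pow Z" "card Y \<le> 2 ^ Suc d * d + 1"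
  obtains T where "T \<subseteq> Z" "card Y + Suc d \<le> 2 ^ Suc d * d + 1 + card {y\<in>Y. f y = T}"
proof -
  define m :: nat where "m = 2 ^ Suc d"
  have cP: "card (Pow Z) = m" using assms by (simp add: card_Pow m_def)
  have "\<exists>T\<in>Pow Z. card Y + Suc d \<le> m * d + 1 + card {y\<in>Y. f y = T}"
  proof (rule ccontr)
    assume "\<not> ?thesis"
    then have "\<forall>T\<in>Pow Z. m * d + 1 + card {y\<in>Y. f y = T} < card Y + Suc d"
      by (simp only: bex_simps not_le)
    then have *: "m * d + 1 + card {y\<in>Y. f y = T} + 1 \<le> card Y + Suc d" if "T \<in> Pow Z" for T
      using bspec[OF _ that] by (simp only: Suc_eq_plus1[symmetric] Suc_le_eq)
    have "card Y = (\<Sum>T\<in>Pow Z. card {y\<in>Y. f y = T})"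
      using sum.group[of Y "Pow Z" f "\<lambda>_. 1::nat"] assms by simp
    then have "m * (m * d + 2) + card Y = (\<Sum>T\<in>Pow Z. m * d + 1 + card {y\<in>Y. f y = T} + 1)"
      unfolding sum.distrib by (simp add: cP algebra_simps)
    also have "\<dots> \<le> (\<Sum>T\<in>Pow Z. card Y + Suc d)" by (intro sum_mono *)
    also have "\<dots> = m * (card Y + Suc d)" by (simp add: cP)
    finally have le: "m * (m * d + 2) + card Y \<le> m * (card Y + Suc d)" .
    obtain j where j: "m * d + 1 = card Y + j" using assms(5) le_Suc_ex unfolding m_def by blast
    have "m * (m * d + 2) = m * card Y + m * j + m"
      using j by (metis add.assoc add_mult_distrib2 mult.right_neutral one_add_one)
    moreover have "m * (card Y + Suc d) = m * card Y + m * d + m" by (simp add: algebra_simps)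
    moreover have "j \<le> m * j" by (simp add: m_def)
    ultimately show False using le j by linarith
  qed
  then show ?thesis using that unfolding m_def by blast
qed

text \<open>The pigeonhole argument of Chen, Cheng and Tang for teaching sets, relative to a filter. A
  minimal based filter takes the place of a smallest nonempty subclass defined by \<open>k\<close> values.\<close>

lemma ex_based_filter:
  fixes F :: "'b filter" and d :: nat
  assumes F: "F \<noteq> bot" and vc: "vc_below r A (Suc (Suc d)) F"
  obtains G where "G \<le> F" "G \<noteq> bot" "based r A (2 ^ Suc d * d + 1) F G" "vc_below r A (Suc d) G"
proof -
  define k where "k = 2 ^ Suc d * d + 1"
  let ?S = "{G. G \<le> F \<and> G \<noteq> bot \<and> based r A k F G}"
  have "based r A k F F"
    unfolding based_def by (intro allI impI exI[of _ "{}"]) (simp add: agree_def[abs_def])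
  with F have "F \<in> ?S" by simp
  moreover have "Inf C \<in> ?S" if C: "C \<subseteq> ?S" "C \<noteq> {}"
    "\<And>G H. G \<in> C \<Longrightarrow> H \<in> C \<Longrightarrow> G \<le> H \<or> H \<le> G" for C
  proof -
    have "Inf C \<noteq> bot" using C by (intro Inf_chain_not_bot) auto
    moreover have "Inf C \<le> F" using C(1,2)
      by (metis (no_types, lifting) Inf_lower2 ex_in_conv mem_Collect_eq subsetD)
    moreover have "based r A k F (Inf C)"
      unfolding based_def
    proof (intro allI impI)
      fix P assume "eventually P (Inf C)"
      then obtain G where G: "G \<in> C" "eventually P G" using eventually_Inf_chain[OF C(2,3)] by blast
      then have "based r A k F G" using C(1) by auto
      from basedE[OF this G(2)] obtain Y s where Y: "Y \<subseteq> A" "finite Y" "card Y \<le> k"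
        "\<forall>\<^sub>F c in G. agree r s Y c" "\<forall>\<^sub>F c in F. agree r s Y c \<longrightarrow> P c" by blast
      have "\<forall>\<^sub>F c in Inf C. agree r s Y c"
        using Y(4) G(1) eventually_Inf_chain[OF C(2,3)] by blast
      with Y show "\<exists>Y s. Y \<subseteq> A \<and> finite Y \<and> card Y \<le> k \<and>
        (\<forall>\<^sub>F c in Inf C. agree r s Y c) \<and> (\<forall>\<^sub>F c in F. agree r s Y c \<longrightarrow> P c)" by blast
    qed
    ultimately show ?thesis by simp
  qed
  ultimately obtain G where G: "G \<in> ?S" and min: "\<And>H. H \<in> ?S \<Longrightarrow> H \<le> G \<Longrightarrow> H = G"
    by (rule ex_minimal_filter) blast+
  then have GF: "G \<le> F" and Gbot: "G \<noteq> bot" and base: "based r A k F G" by auto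
  have "vc_below r A (Suc d) G"
    unfolding vc_below_def
  proof (intro allI impI, elim conjE, rule ccontr)
    fix Z assume Z: "Z \<subseteq> A" "finite Z" "card Z = Suc d"
      and "\<not> (\<exists>T\<subseteq>Z. \<forall>\<^sub>F c in G. \<not> agree r (\<lambda>a. a \<in> T) Z c)"
    then have fr: "\<exists>\<^sub>F c in G. agree r (\<lambda>a. a \<in> T) Z c" if "T \<subseteq> Z" for T
      using that by (simp add: frequently_def)
    \<comment> \<open>This is what makes \<open>G\<close>, restricted to the pattern
      \<open>T\<close> on \<open>Z\<close>, based again: boundedly many values that follow from
      \<open>T\<close> inside \<open>G\<close> and force both \<open>P\<close> and \<open>T\<close>
      inside \<open>F\<close>.\<close>
    define \<Phi> where "\<Phi> P T \<longleftrightarrow> (\<exists>Y s. Y \<subseteq> A \<and> finite Y \<and> card Y \<le> k \<and>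
       (\<forall>\<^sub>F c in G. agree r (\<lambda>a. a \<in> T) Z c \<longrightarrow> agree r s Y c) \<and>
       (\<forall>\<^sub>F c in F. agree r s Y c \<longrightarrow> P c \<and> agree r (\<lambda>a. a \<in> T) Z c))" for P T
    have \<Phi>: "\<exists>T\<subseteq>Z. \<Phi> P T" if P: "eventually P G" for P
    proof -
      obtain Y s where Y: "Y \<subseteq> A" "finite Y" "card Y \<le> k"
        and sG: "\<forall>\<^sub>F c in G. agree r s Y c" and sF: "\<forall>\<^sub>F c in F. agree r s Y c \<longrightarrow> P c"
        using basedE[OF base P] by blast
      have sG1: "\<forall>\<^sub>F c in G. r y c = s y" if "y \<in> Y" for y
        using sG by eventually_elim (use that in \<open>auto simp: agree_def\<close>)
      have disj: "y \<notin> Z" if "y \<in> Y" for y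
      proof
        assume "y \<in> Z"
        \<comment> \<open>A pattern on \<open>Z\<close> with the value at \<open>y\<close> opposite
          to the one that \<open>G\<close> has fixed.\<close>
        define T where "T = (if s y then {} else {y})"
        have "T \<subseteq> Z" using \<open>y \<in> Z\<close> by (simp add: T_def)
        then have "\<exists>\<^sub>F c in G. agree r (\<lambda>a. a \<in> T) Z c \<and> r y c = s y"
          using frequently_eventually_frequently[OF fr sG1] that by blast
        then obtain c where "agree r (\<lambda>a. a \<in> T) Z c" "r y c = s y" by (auto elim: frequentlyE)
        then have "(y \<in> T) = s y" using \<open>y \<in> Z\<close> by (simp add: agree_def)
        then show False by (simp add: T_def split: if_splits)
      qed
      \<comment> \<open>\<open>insert y Z\<close> has one point too many to be shattered over
        \<open>F\<close>, so some pattern is excluded. Its restriction to \<open>Z\<close> does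
        occur in \<open>G\<close>, together with the value \<open>s y\<close>; the excluded value at
        \<open>y\<close> is therefore the other one, and the restriction forces
        \<open>s y\<close>.\<close>
      have "\<exists>T\<subseteq>Z. \<forall>\<^sub>F c in F. agree r (\<lambda>a. a \<in> T) Z c \<longrightarrow> r y c = s y" if y: "y \<in> Y" for y
      proof -
        have "card (insert y Z) = Suc (Suc d)" "insert y Z \<subseteq> A"
          using Z Y y disj by auto
        then obtain T where T: "T \<subseteq> insert y Z" "\<forall>\<^sub>F c in F. \<not> agree r (\<lambda>a. a \<in> T) (insert y Z) c"
          using vc Z(2) unfolding vc_below_def by (metis finite_insert)
        let ?T = "T - {y}"
        have eq: "agree r (\<lambda>a. a \<in> ?T) Z c \<longleftrightarrow> agree r (\<lambda>a. a \<in> T) Z c" for c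
          using disj[OF y] unfolding agree_def by auto
        have TZ: "?T \<subseteq> Z" using T(1) by auto
        have "\<exists>\<^sub>F c in G. (agree r (\<lambda>a. a \<in> ?T) Z c \<and> r y c = s y) \<and> \<not> agree r (\<lambda>a. a \<in> T) (insert y Z) c"
          using fr[OF TZ] sG1[OF y] filter_leD[OF GF T(2)]
          by (intro frequently_eventually_frequently)
        then obtain c where "(agree r (\<lambda>a. a \<in> ?T) Z c \<and> r y c = s y) \<and> \<not> agree r (\<lambda>a. a \<in> T) (insert y Z) c"
          by (auto elim: frequentlyE)
        then have "(y \<in> T) \<noteq> s y" unfolding eq by auto
        then have "\<forall>\<^sub>F c in F. agree r (\<lambda>a. a \<in> ?T) Z c \<longrightarrow> r y c = s y"
          using T(2) unfolding eq by (auto elim!: eventually_mono)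
        then show ?thesis using TZ by blast
      qed
      then obtain f where f: "\<And>y. y \<in> Y \<Longrightarrow> f y \<subseteq> Z"
        "\<And>y. y \<in> Y \<Longrightarrow> \<forall>\<^sub>F c in F. agree r (\<lambda>a. a \<in> f y) Z c \<longrightarrow> r y c = s y"
        by metis
      obtain T where T: "T \<subseteq> Z" "card Y + Suc d \<le> 2 ^ Suc d * d + 1 + card {y\<in>Y. f y = T}"
        by (rule pigeonhole_patterns[of Y Z d f])
          (use Y Z k_def f(1) in \<open>simp_all add: image_subset_iff\<close>)
      \<comment> \<open>The values on \<open>Y'\<close> are all forced by the single pattern
        \<open>T\<close>, so prescribing \<open>T\<close> on \<open>Z\<close> replaces them.\<close>
      define Y' where "Y' = {y\<in>Y. f y = T}"
      define s' where "s' a = (if a \<in> Z then a \<in> T else s a)" for a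
      have s'Z: "agree r s' Z c \<longleftrightarrow> agree r (\<lambda>a. a \<in> T) Z c" for c
        unfolding agree_def s'_def by auto
      have s'Y: "agree r s' (Y - Y') c \<longleftrightarrow> agree r s (Y - Y') c" for c
        using disj unfolding agree_def s'_def by auto
      have fin: "finite Y'" "Y' \<subseteq> Y" using Y by (auto simp: Y'_def)
      have "card (Y - Y' \<union> Z) \<le> card (Y - Y') + card Z" by (rule card_Un_le)
      also have "\<dots> = card Y - card Y' + Suc d" using fin Z by (simp add: card_Diff_subset)
      also have "\<dots> \<le> k"
        using T(2) card_mono[OF Y(2) fin(2)] unfolding k_def Y'_def[symmetric] by linarith
      finally have card: "card (Y - Y' \<union> Z) \<le> k" .
      have "\<forall>\<^sub>F c in F. \<forall>y\<in>Y'. agree r (\<lambda>a. a \<in> T) Z c \<longrightarrow> r y c = s y"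
        using fin f(2) by (intro eventually_ball_finite) (auto simp: Y'_def)
      with sF have "\<forall>\<^sub>F c in F. agree r s' (Y - Y' \<union> Z) c \<longrightarrow> P c \<and> agree r (\<lambda>a. a \<in> T) Z c"
        by eventually_elim (auto simp: s'Z s'Y, auto simp: agree_def)
      moreover have "\<forall>\<^sub>F c in G. agree r (\<lambda>a. a \<in> T) Z c \<longrightarrow> agree r s' (Y - Y' \<union> Z) c"
        using sG by eventually_elim (auto simp: s'Z s'Y intro: agree_subset)
      ultimately have "\<Phi> P T"
        unfolding \<Phi>_def using card Y Z fin
        by (intro exI[of _ "Y - Y' \<union> Z"] exI[of _ s']) auto
      with T(1) show ?thesis by blast
    qed
    \<comment> \<open>So far \<open>T\<close> depends on \<open>P\<close>. There are finitely many
      patterns and \<Phi> is monotone in \<open>P\<close>, so counterexamples for all patterns could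
      be intersected into one.\<close>
    have "\<exists>T\<subseteq>Z. \<forall>P. eventually P G \<longrightarrow> \<Phi> P T"
    proof (rule ccontr)
      assume "\<not> ?thesis"
      then obtain Q where Q: "\<And>T. T \<subseteq> Z \<Longrightarrow> eventually (Q T) G" "\<And>T. T \<subseteq> Z \<Longrightarrow> \<not> \<Phi> (Q T) T"
        by metis
      have "\<forall>\<^sub>F c in G. \<forall>T\<in>Pow Z. Q T c" using Q Z by (intro eventually_ball_finite) auto
      from \<Phi>[OF this] obtain T where T: "T \<subseteq> Z" "\<Phi> (\<lambda>c. \<forall>T\<in>Pow Z. Q T c) T" by blast
      then have "\<Phi> (Q T) T" unfolding \<Phi>_def
        by (elim ex_forward conj_forward) (auto elim!: eventually_mono)
      with Q(2) T(1) show False by blast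
    qed
    then obtain T where T: "T \<subseteq> Z" "\<And>P. eventually P G \<Longrightarrow> \<Phi> P T" by blast
    define H where "H = inf G (principal {c. agree r (\<lambda>a. a \<in> T) Z c})"
    have "H \<noteq> bot" using fr[OF T(1)]
      by (simp add: H_def trivial_limit_def eventually_inf_principal frequently_def)
    moreover have "based r A k F H"
      unfolding based_def
    proof (intro allI impI)
      fix P assume "eventually P H"
      then have "\<forall>\<^sub>F c in G. agree r (\<lambda>a. a \<in> T) Z c \<longrightarrow> P c"
        by (simp add: H_def eventually_inf_principal)
      from T(2)[OF this] obtain Y s where Y: "Y \<subseteq> A" "finite Y" "card Y \<le> k"
        "\<forall>\<^sub>F c in G. agree r (\<lambda>a. a \<in> T) Z c \<longrightarrow> agree r s Y c"
        "\<forall>\<^sub>F c in F. agree r s Y c \<longrightarrow> (agree r (\<lambda>a. a \<in> T) Z c \<longrightarrow> P c) \<and> agree r (\<lambda>a. a \<in> T) Z c"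
        unfolding \<Phi>_def by blast
      have "\<forall>\<^sub>F c in F. agree r s Y c \<longrightarrow> P c" using Y(5) by (auto elim: eventually_mono)
      with Y show "\<exists>Y s. Y \<subseteq> A \<and> finite Y \<and> card Y \<le> k \<and>
        (\<forall>\<^sub>F c in H. agree r s Y c) \<and> (\<forall>\<^sub>F c in F. agree r s Y c \<longrightarrow> P c)"
        unfolding H_def eventually_inf_principal by auto
    qed
    \<comment> \<open>Minimality makes the restriction no restriction at all: \<open>G\<close>
      already decides \<open>Z\<close>.\<close>
    ultimately have "H = G" using GF by (intro min) (auto simp: H_def intro: le_infI1)
    moreover have "\<forall>\<^sub>F c in H. agree r (\<lambda>a. a \<in> T) Z c"
      unfolding H_def eventually_inf_principal by simp
    ultimately have ev: "\<forall>\<^sub>F c in G. agree r (\<lambda>a. a \<in> T) Z c" by simp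
    obtain z where z: "z \<in> Z" using Z by fastforce
    \<comment> \<open>\<open>Z\<close> is nonempty because it has \<open>Suc d\<close> elements; the
      pattern flipped at \<open>z\<close> should also be frequent, which contradicts the
      decision.\<close>
    define T' where "T' = (if z \<in> T then {} else {z})"
    have "T' \<subseteq> Z" using z by (simp add: T'_def)
    then have "\<exists>\<^sub>F c in G. agree r (\<lambda>a. a \<in> T') Z c \<and> agree r (\<lambda>a. a \<in> T) Z c"
      using frequently_eventually_frequently[OF fr ev] by blast
    then obtain c where "agree r (\<lambda>a. a \<in> T') Z c" "agree r (\<lambda>a. a \<in> T) Z c"
      by (auto elim: frequentlyE)
    then have "z \<in> T' \<longleftrightarrow> z \<in> T" using z by (simp add: agree_def)
    then show False by (simp add: T'_def split: if_splits)
  qed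
  with GF Gbot base show ?thesis using that unfolding k_def by blast
qed

text \<open>The closed form is the sum of \<open>2 ^ Suc i * i + 1\<close> over
  \<open>i < d\<close>, one pigeonhole constant for each lowering of the VC-dimension.\<close>

lemma k_comp_0: "k_comp 0 = 0" and k_comp_Suc: "k_comp (Suc d) = k_comp d + (2 ^ Suc d * d + 1)"
proof -
  show "k_comp 0 = 0" by (simp add: k_comp_def)
  have "2 ^ (d + 1) * (int d - 2) + int d + 4 \<ge> 0" for d :: nat
  proof (cases "d < 2")
    case True
    then have "d = 0 \<or> d = 1" by auto
    then show ?thesis by auto
  next
    case False
    then have "2 ^ (d + 1) * (int d - 2) \<ge> 0" by (intro mult_nonneg_nonneg) auto
    then show ?thesis by linarith
  qed
  then have k: "int (k_comp d) = 2 ^ (d + 1) * (int d - 2) + int d + 4" for d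
    unfolding k_comp_def by simp
  have "int (k_comp (Suc d)) = int (k_comp d + (2 ^ Suc d * d + 1))"
    unfolding of_nat_add k by (simp add: algebra_simps)
  then show "k_comp (Suc d) = k_comp d + (2 ^ Suc d * d + 1)" by linarith
qed

text \<open>Induction on the VC-dimension. A type compressible in the smaller filter
  \<open>G\<close> has its values on \<open>A\<^sub>0\<close> decided by a set \<open>Y\<close>
  eventually in \<open>G\<close>, and \<open>based\<close> turns this event into boundedly many
  further values over \<open>F\<close>. At dimension \<open>0\<close> every value is eventually
  constant, so nothing has to be prescribed.\<close>

theorem ex_compressible:
  fixes F :: "'b filter"
  assumes "F \<noteq> bot" "vc_below r A (Suc d) F"
  shows "\<exists>p. compressible r A (k_comp d) F p"
  using assms
proof (induction d arbitrary: F)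
  case 0
  have "\<exists>v. \<forall>\<^sub>F c in F. r a c = v" if "a \<in> A" for a
  proof -
    have "{a} \<subseteq> A" "finite {a}" "card {a} = Suc 0" using that by auto
    then obtain T where "\<forall>\<^sub>F c in F. \<not> agree r (\<lambda>a. a \<in> T) {a} c"
      using 0(2) unfolding vc_below_def by blast
    then have "\<forall>\<^sub>F c in F. r a c = (a \<notin> T)" by (auto simp: agree_def elim!: eventually_mono)
    then show ?thesis by blast
  qed
  then obtain p where p: "\<And>a. a \<in> A \<Longrightarrow> \<forall>\<^sub>F c in F. r a c = p a" by metis
  have *: "\<forall>\<^sub>F c in F. agree r p A\<^sub>0 c" if "A\<^sub>0 \<subseteq> A" "finite A\<^sub>0" for A\<^sub>0
    unfolding agree_def using that p by (intro eventually_ball_finite) auto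
  have "compressible r A 0 F p"
    unfolding compressible_def
  proof (intro allI impI conjI)
    fix A\<^sub>0 assume A0: "A\<^sub>0 \<subseteq> A" "finite A\<^sub>0"
    show "\<exists>Y\<subseteq>A. finite Y \<and> card Y \<le> 0 \<and> (\<forall>\<^sub>F c in F. agree r p Y c \<longrightarrow> agree r p A\<^sub>0 c)"
      by (rule exI[of _ "{}"]) (use *[OF A0] in \<open>auto elim!: eventually_mono\<close>)
    show "\<exists>\<^sub>F c in F. agree r p A\<^sub>0 c" using *[OF A0] 0(1) by (simp add: eventually_frequently)
  qed
  then show ?case by (auto simp: k_comp_0)
next
  case (Suc d)
  obtain G where G: "G \<le> F" "G \<noteq> bot" "based r A (2 ^ Suc d * d + 1) F G" "vc_below r A (Suc d) G"
    using ex_based_filter[OF Suc.prems] by blast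
  obtain p where p: "compressible r A (k_comp d) G p" using Suc.IH[OF G(2,4)] by blast
  have "compressible r A (k_comp (Suc d)) F p"
    unfolding compressible_def
  proof (intro allI impI conjI)
    fix A\<^sub>0 assume A0: "A\<^sub>0 \<subseteq> A" "finite A\<^sub>0"
    then have "\<exists>\<^sub>F c in G. agree r p A\<^sub>0 c" using p by (simp add: compressible_def)
    then show "\<exists>\<^sub>F c in F. agree r p A\<^sub>0 c" using filter_leD[OF G(1)] by (auto simp: frequently_def)
    obtain Y where Y: "Y \<subseteq> A" "finite Y" "card Y \<le> k_comp d"
      "\<forall>\<^sub>F c in G. agree r p Y c \<longrightarrow> agree r p A\<^sub>0 c"
      using p A0 unfolding compressible_def by blast
    obtain Y' s where Y': "Y' \<subseteq> A" "finite Y'" "card Y' \<le> 2 ^ Suc d * d + 1"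
      "\<forall>\<^sub>F c in G. agree r s Y' c" "\<forall>\<^sub>F c in F. agree r s Y' c \<longrightarrow> agree r p Y c \<longrightarrow> agree r p A\<^sub>0 c"
      using basedE[OF G(3) Y(4)] by blast
    \<comment> \<open>The values \<open>s\<close> provided by \<open>based\<close> hold eventually
      in \<open>G\<close>, and \<open>p\<close> is consistent with \<open>G\<close>; hence they are
      values of \<open>p\<close>.\<close>
    have "\<exists>\<^sub>F c in G. agree r p Y' c \<and> agree r s Y' c"
      using p Y' by (intro frequently_eventually_frequently) (auto simp: compressible_def)
    then obtain c where "agree r p Y' c \<and> agree r s Y' c" by (auto elim: frequentlyE)
    then have eq: "agree r p Y' c = agree r s Y' c" for c by (auto simp: agree_def)
    have "card (Y \<union> Y') \<le> k_comp (Suc d)"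
      using card_Un_le[of Y Y'] Y Y' by (simp add: k_comp_Suc)
    then show "\<exists>Y\<subseteq>A. finite Y \<and> card Y \<le> k_comp (Suc d) \<and> (\<forall>\<^sub>F c in F. agree r p Y c \<longrightarrow> agree r p A\<^sub>0 c)"
      using Y Y' by (intro exI[of _ "Y \<union> Y'"]) (auto simp: eq elim!: eventually_mono)
  qed
  then show ?case by blast
qed

section \<open>The Sauer--Shelah bound\<close>

text \<open>Pajor's form, by deleting a point \<open>x\<close>: \<open>\<F>\<close> has as many
  members as \<open>G\<close> (the members without \<open>x\<close>) and \<open>H\<close> (those
  occurring both with and without \<open>x\<close>) together. Sets shattered by \<open>G\<close>
  avoid \<open>x\<close>, and those shattered by \<open>H\<close> remain shattered after adding
  \<open>x\<close>.\<close>

lemma sauer_shelah_pajor: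
  assumes "finite P" "\<F> \<subseteq> Pow P"
  shows "card \<F> \<le> card {S. S \<subseteq> P \<and> shatters \<F> S}"
  using assms
proof (induction P arbitrary: \<F> rule: finite_induct)
  case empty
  then have "\<F> = {} \<or> \<F> = {{}}" by auto
  then show ?case
  proof
    assume "\<F> = {{}}"
    then have "{S. S \<subseteq> {} \<and> shatters \<F> S} = {{}}" by (auto simp: shatters_def)
    then show ?thesis using \<open>\<F> = {{}}\<close> by simp
  qed simp
next
  case (insert x P)
  define G where "G = (\<lambda>S. S - {x}) ` \<F>"
  define H where "H = {S. S \<subseteq> P \<and> S \<in> \<F> \<and> insert x S \<in> \<F>}"
  have finF: "finite \<F>" using insert.prems insert.hyps by (auto intro: finite_subset)
  have G: "G \<subseteq> Pow P" and H: "H \<subseteq> Pow P" using insert.prems by (auto simp: G_def H_def)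
  let ?F0 = "{S\<in>\<F>. x \<notin> S}" and ?F1 = "{S\<in>\<F>. x \<in> S}"
  let ?F1' = "(\<lambda>S. S - {x}) ` ?F1"
  have c1: "card ?F1' = card ?F1"
    by (rule card_image) (auto simp: inj_on_def)
  have "(\<lambda>S. S - {x}) ` ?F0 = (\<lambda>S. S) ` ?F0" by (rule image_cong) auto
  moreover have "G = (\<lambda>S. S - {x}) ` ?F0 \<union> ?F1'"
    unfolding G_def image_Un[symmetric] by (rule arg_cong[where f = "image _"]) auto
  ultimately have "G = ?F0 \<union> ?F1'" by simp
  moreover have "H = ?F0 \<inter> ?F1'"
    using insert.hyps(2) insert.prems by (auto simp: H_def image_def insert_absorb)
  moreover have "card (?F0 \<union> ?F1') + card (?F0 \<inter> ?F1') = card ?F0 + card ?F1'"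
    using finF by (intro card_Un_Int[symmetric]) auto
  moreover have "card \<F> = card ?F0 + card ?F1"
    using finF by (subst card_Un_disjoint[symmetric]) (auto intro: arg_cong[where f = card])
  ultimately have card: "card \<F> = card G + card H" using c1 by simp
  let ?sG = "{S. S \<subseteq> P \<and> shatters G S}" and ?sH = "{S. S \<subseteq> P \<and> shatters H S}"
  have fin: "finite ?sG" "finite ?sH" using insert.hyps(1) by auto
  have "shatters \<F> S" if "S \<subseteq> P" "shatters G S" for S
  proof -
    have "x \<notin> S" using that(1) insert.hyps by auto
    then have "(\<lambda>F. F \<inter> S) ` G = (\<lambda>F. F \<inter> S) ` \<F>"
      unfolding G_def image_image by (intro image_cong) auto
    then show ?thesis using that(2) by (simp add: shatters_def)
  qed
  moreover have "shatters \<F> (insert x S)" if S: "S \<subseteq> P" "shatters H S" for S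
    unfolding shatters_def
  proof (intro equalityI subsetI)
    fix T assume "T \<in> Pow (insert x S)"
    then have "T - {x} \<in> (\<lambda>F. F \<inter> S) ` H" using S(2) unfolding shatters_def by blast
    then obtain F where F: "F \<in> H" "T - {x} = F \<inter> S" by auto
    have "x \<notin> F" "x \<notin> S" using F(1) insert.hyps(2) S(1) by (auto simp: H_def)
    show "T \<in> (\<lambda>F. F \<inter> insert x S) ` \<F>"
    proof (cases "x \<in> T")
      case True
      then have "T = insert x F \<inter> insert x S" using F(2) \<open>x \<notin> S\<close> by auto
      then show ?thesis using F(1) by (auto simp: H_def)
    next
      case False
      then have "T = F \<inter> insert x S" using F(2) \<open>x \<notin> F\<close> by auto
      then show ?thesis using F(1) by (auto simp: H_def)
    qed
  qed auto
  ultimately have "?sG \<union> insert x ` ?sH \<subseteq> {S. S \<subseteq> insert x P \<and> shatters \<F> S}" by auto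
  then have "card (?sG \<union> insert x ` ?sH) \<le> card {S. S \<subseteq> insert x P \<and> shatters \<F> S}"
    using insert.hyps(1) by (intro card_mono) auto
  moreover have "card (?sG \<union> insert x ` ?sH) = card ?sG + card (insert x ` ?sH)"
    using fin insert.hyps(2) by (intro card_Un_disjoint) auto
  moreover have "card (insert x ` ?sH) = card ?sH"
    using insert.hyps(2) by (intro card_image) (auto simp: inj_on_def)
  ultimately show ?case using insert.IH[OF G] insert.IH[OF H] card by linarith
qed

text \<open>A subset with at most \<open>d\<close> elements is read off from a list of length
  \<open>d\<close> in which \<open>None\<close> is padding. The crude polynomial suffices, as it is
  only compared with an exponential.\<close>

lemma card_subsets_le:
  assumes "finite P"
  shows "card {S. S \<subseteq> P \<and> card S \<le> d} \<le> (card P + 1) ^ d"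
proof -
  define L where "L = {xs :: 'a option list. set xs \<subseteq> insert None (Some ` P) \<and> length xs = d}"
  have "card (insert None (Some ` P)) = card P + 1"
    using assms by (simp add: card_image)
  then have L: "finite L" "card L = (card P + 1) ^ d"
    unfolding L_def using assms by (simp_all add: finite_lists_length_eq card_lists_length_eq)
  have "{S. S \<subseteq> P \<and> card S \<le> d} \<subseteq> (\<lambda>xs. {a. Some a \<in> set xs}) ` L"
  proof
    fix S assume "S \<in> {S. S \<subseteq> P \<and> card S \<le> d}"
    then have S: "S \<subseteq> P" "card S \<le> d" by auto
    then obtain xs where xs: "set xs = S" "distinct xs"
      using assms finite_distinct_list finite_subset by metis
    let ?ys = "map Some xs @ replicate (d - length xs) None"
    have "length xs = card S" using xs distinct_card by metis
    then have "?ys \<in> L" using xs S by (auto simp: L_def)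
    moreover have "S = {a. Some a \<in> set ?ys}" using xs by auto
    ultimately show "S \<in> (\<lambda>xs. {a. Some a \<in> set xs}) ` L" by (rule rev_image_eqI)
  qed
  then have "card {S. S \<subseteq> P \<and> card S \<le> d} \<le> card L"
    using surj_card_le[OF L(1)] by blast
  then show ?thesis using L by simp
qed

lemma vc_below_principal:
  "vc_below r A d (principal B) \<longleftrightarrow>
     (\<forall>Z\<subseteq>A. finite Z \<and> card Z = d \<longrightarrow> (\<exists>T\<subseteq>Z. \<forall>c\<in>B. \<not> agree r (\<lambda>a. a \<in> T) Z c))"
  by (simp add: vc_below_def eventually_principal)

lemma card_traces_le:
  assumes vc: "vc_below r A (Suc d) (principal B)" and P: "finite P" "P \<subseteq> A"
  shows "card ((\<lambda>c. {a\<in>P. r a c}) ` B) \<le> (card P + 1) ^ d"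
proof -
  let ?F = "(\<lambda>c. {a\<in>P. r a c}) ` B"
  have "card ?F \<le> card {S. S \<subseteq> P \<and> shatters ?F S}"
    by (rule sauer_shelah_pajor) (use P in auto)
  also have "\<dots> \<le> card {S. S \<subseteq> P \<and> card S \<le> d}"
  proof (rule card_mono)
    show "finite {S. S \<subseteq> P \<and> card S \<le> d}" using P by auto
    have "card S \<le> d" if S: "S \<subseteq> P" "shatters ?F S" for S
    proof (rule ccontr)
      assume "\<not> card S \<le> d"
      then have "Suc d \<le> card S" by simp
      from obtain_subset_with_card_n[OF this]
      obtain Z where Z: "Z \<subseteq> S" "card Z = Suc d" "finite Z" by blast
      then have "Z \<subseteq> A" using S P by auto
      then have "\<exists>T\<subseteq>Z. \<forall>c\<in>B. \<not> agree r (\<lambda>a. a \<in> T) Z c"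
        using vc[unfolded vc_below_principal, rule_format] Z(2,3) by simp
      then obtain T where T: "T \<subseteq> Z" "\<forall>c\<in>B. \<not> agree r (\<lambda>a. a \<in> T) Z c" by blast
      have "T \<in> Pow S" using T(1) Z(1) by blast
      then have "T \<in> (\<lambda>F. F \<inter> S) ` ?F" using S(2) unfolding shatters_def by simp
      then obtain c where c: "c \<in> B" "T = {a\<in>P. r a c} \<inter> S" by auto
      then have "agree r (\<lambda>a. a \<in> T) Z c" using Z(1) S(1) by (auto simp: agree_def)
      with T(2) c(1) show False by blast
    qed
    then show "{S. S \<subseteq> P \<and> shatters ?F S} \<subseteq> {S. S \<subseteq> P \<and> card S \<le> d}" by auto
  qed
  also have "\<dots> \<le> (card P + 1) ^ d" by (rule card_subsets_le[OF P(1)])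
  finally show ?thesis .
qed

section \<open>Compressible types close to a given one\<close>

text \<open>The nested quantifiers express agreement with \<open>q\<close> on \<open>m\<close> subsets, each generic in the sense of \<open>U\<close>
  over the ones chosen before it.\<close>

primrec generic_filter :: "('a \<Rightarrow> 'b \<Rightarrow> bool) \<Rightarrow> ('a \<Rightarrow> bool) \<Rightarrow> 'a set filter \<Rightarrow> 'b filter \<Rightarrow> nat \<Rightarrow> 'b filter" where
  "generic_filter r q U F 0 = F"
| "generic_filter r q U F (Suc m) =
     Abs_filter (\<lambda>P. \<forall>\<^sub>F X in U. \<forall>\<^sub>F c in generic_filter r q U F m. agree r q X c \<longrightarrow> P c)"

lemma eventually_generic_filter_Suc:
  fixes r :: "'a \<Rightarrow> 'b \<Rightarrow> bool"
  shows "eventually P (generic_filter r q U F (Suc m)) \<longleftrightarrow>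
     (\<forall>\<^sub>F X in U. \<forall>\<^sub>F c in generic_filter r q U F m. agree r q X c \<longrightarrow> P c)"
  unfolding generic_filter.simps
proof (rule eventually_Abs_filter, rule is_filter.intro)
  show "\<forall>\<^sub>F X in U. \<forall>\<^sub>F c in generic_filter r q U F m. agree r q X c \<longrightarrow> True" by simp
next
  fix P Q
  assume "\<forall>\<^sub>F X in U. \<forall>\<^sub>F c in generic_filter r q U F m. agree r q X c \<longrightarrow> P c"
    "\<forall>\<^sub>F X in U. \<forall>\<^sub>F c in generic_filter r q U F m. agree r q X c \<longrightarrow> Q c"
  then show "\<forall>\<^sub>F X in U. \<forall>\<^sub>F c in generic_filter r q U F m. agree r q X c \<longrightarrow> P c \<and> Q c"
  proof eventually_elim
    case (elim X)
    then show ?case by eventually_elim blast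
  qed
next
  fix P Q :: "'b \<Rightarrow> bool"
  assume "\<forall>x. P x \<longrightarrow> Q x" "\<forall>\<^sub>F X in U. \<forall>\<^sub>F c in generic_filter r q U F m. agree r q X c \<longrightarrow> P c"
  then show "\<forall>\<^sub>F X in U. \<forall>\<^sub>F c in generic_filter r q U F m. agree r q X c \<longrightarrow> Q c"
    by (auto elim!: eventually_mono)
qed

lemma generic_filter_Suc_le: "generic_filter r q U F (Suc m) \<le> generic_filter r q U F m"
proof (rule filter_leI)
  fix P assume "eventually P (generic_filter r q U F m)"
  then have "\<forall>\<^sub>F c in generic_filter r q U F m. agree r q X c \<longrightarrow> P c" for X by (rule eventually_mono) simp
  then show "eventually P (generic_filter r q U F (Suc m))" unfolding eventually_generic_filter_Suc by simp
qed

lemma generic_filter_le: "generic_filter r q U F m \<le> F"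
  by (induction m) (auto intro: order_trans[OF generic_filter_Suc_le] simp del: generic_filter.simps(2))

text \<open>\<open>b\<close> agrees with its own values on every subset and so survives all generic
  restrictions; in particular these filters are proper.\<close>

lemma eventually_generic_filter_base_point:
  assumes "U \<noteq> bot" "b \<in> B"
  shows "eventually P (generic_filter r (\<lambda>a. r a b) U (principal B) m) \<Longrightarrow> P b"
proof (induction m arbitrary: P)
  case 0
  then show ?case using assms by (simp add: eventually_principal)
next
  case (Suc m)
  from Suc.prems have "\<forall>\<^sub>F X in U. P b"
    unfolding eventually_generic_filter_Suc by (rule eventually_mono) (auto dest: Suc.IH simp: agree_def)
  then show ?case using assms(1) by (simp add: eventually_const_iff)
qed

text \<open>The nested generic quantifiers are instantiated one after another by concrete subsets,
  each chosen with the property \<open>Q\<close>; an eventual statement becomes a finite condition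
  valid on all of \<open>B\<close>.\<close>

lemma generic_filter_witness:
  assumes "U \<noteq> bot" "eventually Q U"
  shows "eventually P (generic_filter r q U (principal B) m) \<Longrightarrow>
    \<exists>Xs. length Xs = m \<and> (\<forall>X\<in>set Xs. Q X) \<and> (\<forall>c\<in>B. agree r q (\<Union>(set Xs)) c \<longrightarrow> P c)"
proof (induction m arbitrary: P)
  case 0
  then show ?case by (simp add: eventually_principal)
next
  case (Suc m)
  then have "\<forall>\<^sub>F X in U. (\<forall>\<^sub>F c in generic_filter r q U (principal B) m. agree r q X c \<longrightarrow> P c) \<and> Q X"
    unfolding eventually_generic_filter_Suc using assms(2) by (simp add: eventually_conj_iff)
  then obtain X where X: "\<forall>\<^sub>F c in generic_filter r q U (principal B) m. agree r q X c \<longrightarrow> P c" "Q X"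
    using eventually_happens assms(1) by blast
  from Suc.IH[OF X(1)] obtain Xs where "length Xs = m" "\<forall>X\<in>set Xs. Q X"
    "\<forall>c\<in>B. agree r q (\<Union>(set Xs)) c \<longrightarrow> agree r q X c \<longrightarrow> P c" by blast
  with X(2) show ?case by (intro exI[of _ "X # Xs"]) auto
qed

lemma card_Union_list_le:
  "(\<And>X. X \<in> set Xs \<Longrightarrow> finite X \<and> card X \<le> N) \<Longrightarrow> finite (\<Union>(set Xs)) \<and> card (\<Union>(set Xs)) \<le> N * length Xs"
proof (induction Xs)
  case (Cons X Xs)
  then have "card (X \<union> \<Union>(set Xs)) \<le> N + N * length Xs"
    using card_Un_le[of X "\<Union>(set Xs)"] by (fastforce intro: order_trans add_mono)
  then show ?case using Cons by auto
qed simp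

text \<open>The bound has three parts: \<open>k\<close> values decide \<open>A\<^sub>0\<close>
  relative to the filter, \<open>N * j\<close> values on \<open>X\<close> decide \<open>S\<close>,
  and \<open>N * m\<close> values on concrete subsets replace the generic filter by
  \<open>B\<close>. By \<open>near\<close> these subsets can be taken where \<open>p\<close> and
  \<open>q\<close> coincide, so that the values imposed are values of \<open>p\<close>.\<close>

lemma compressible_of_generic_filter:
  assumes U: "U \<noteq> bot" and ok: "\<forall>\<^sub>F X in U. X \<subseteq> A \<and> finite X \<and> card X \<le> N"
    and X: "X \<subseteq> A" "finite X" "card X \<le> N * j"
    and S: "\<And>c c' p. agree r p X c \<Longrightarrow> agree r p X c' \<Longrightarrow> S c \<Longrightarrow> S c'"
    and p: "compressible r A k (inf (generic_filter r q U (principal B) m) (principal {c. S c})) p"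
    and near: "\<forall>\<^sub>F X in U. \<forall>a\<in>X. p a = q a"
  shows "compressible r A (k + N * (j + m)) (principal B) p"
  unfolding compressible_def
proof (intro allI impI conjI)
  let ?F = "generic_filter r q U (principal B) m"
  have fr: "\<exists>\<^sub>F c in ?F. S c \<and> agree r p A\<^sub>0 c" if "A\<^sub>0 \<subseteq> A" "finite A\<^sub>0" for A\<^sub>0
    using p that by (simp add: compressible_def frequently_def eventually_inf_principal)
  fix A\<^sub>0 assume A0: "A\<^sub>0 \<subseteq> A" "finite A\<^sub>0"
  show "\<exists>\<^sub>F c in principal B. agree r p A\<^sub>0 c"
  proof -
    have "\<exists>\<^sub>F c in ?F. agree r p A\<^sub>0 c" using fr[OF A0] by (rule frequently_elim1) simp
    then show ?thesis using filter_leD[OF generic_filter_le] unfolding frequently_def by blast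
  qed
  obtain Y where Y: "Y \<subseteq> A" "finite Y" "card Y \<le> k"
    "\<forall>\<^sub>F c in ?F. S c \<longrightarrow> agree r p Y c \<longrightarrow> agree r p A\<^sub>0 c"
  proof -
    obtain Y where Y: "Y \<subseteq> A" "finite Y" "card Y \<le> k"
      and *: "\<forall>\<^sub>F c in inf ?F (principal {c. S c}). agree r p Y c \<longrightarrow> agree r p A\<^sub>0 c"
      using compressibleD[OF p A0] by blast
    from * have "\<forall>\<^sub>F c in ?F. S c \<longrightarrow> agree r p Y c \<longrightarrow> agree r p A\<^sub>0 c"
      by (simp add: eventually_inf_principal)
    with Y show ?thesis by (rule that)
  qed
  obtain Xs where Xs: "length Xs = m"
    "\<forall>X\<in>set Xs. (\<forall>a\<in>X. p a = q a) \<and> X \<subseteq> A \<and> finite X \<and> card X \<le> N"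
    "\<forall>c\<in>B. agree r q (\<Union>(set Xs)) c \<longrightarrow> S c \<longrightarrow> agree r p Y c \<longrightarrow> agree r p A\<^sub>0 c"
    using generic_filter_witness[OF U eventually_conj[OF near ok] Y(4)] by blast
  have eq: "agree r q (\<Union>(set Xs)) c \<longleftrightarrow> agree r p (\<Union>(set Xs)) c" for c
    using Xs(2) by (auto simp: agree_def)
  \<comment> \<open>\<open>p\<close> is consistent with \<open>S\<close>, so every parameter with
    the values of \<open>p\<close> on \<open>X\<close> satisfies \<open>S\<close>.\<close>
  obtain c where c: "S c" "agree r p X c" using fr[OF X(1,2)] by (auto elim: frequentlyE)
  have fin: "finite (\<Union>(set Xs))" and cX: "card (\<Union>(set Xs)) \<le> N * m"
    using card_Union_list_le[of Xs N] Xs(1,2) by auto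
  have "card (Y \<union> (X \<union> \<Union>(set Xs))) \<le> card Y + (card X + card (\<Union>(set Xs)))"
    using card_Un_le[of Y "X \<union> \<Union>(set Xs)"] card_Un_le[of X "\<Union>(set Xs)"] by linarith
  also have "\<dots> \<le> k + (N * j + N * m)" using Y(3) X(3) cX by (intro add_mono)
  finally have "card (Y \<union> (X \<union> \<Union>(set Xs))) \<le> k + N * (j + m)" by (simp add: distrib_left)
  moreover have "\<forall>c\<in>B. agree r p (Y \<union> (X \<union> \<Union>(set Xs))) c \<longrightarrow> agree r p A\<^sub>0 c"
    using Xs(3) eq S c by auto
  ultimately show "\<exists>Y\<subseteq>A. finite Y \<and> card Y \<le> k + N * (j + m) \<and>
      (\<forall>\<^sub>F c in principal B. agree r p Y c \<longrightarrow> agree r p A\<^sub>0 c)"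
    using Y X Xs(2) fin by (intro exI[of _ "Y \<union> (X \<union> \<Union>(set Xs))"]) (auto simp: eventually_principal)
qed

text \<open>Each step of the construction spends one level of the generic filter, so the number
  \<open>M\<close> of steps is fixed in advance: after \<open>j\<close> steps all patterns are
  frequent in \<open>F (M - j)\<close>, with \<open>M - j\<close> generic agreements in
  reserve.\<close>

theorem ex_compressible_near:
  assumes U: "U \<noteq> bot" and ultra: "\<And>P. eventually P U \<or> (\<forall>\<^sub>F X in U. \<not> P X)"
    and ok: "\<forall>\<^sub>F X in U. X \<subseteq> A \<and> finite X \<and> card X \<le> N"
    and b: "b \<in> B" and vc: "vc_below r A (Suc d) (principal B)"
    and M: "(N * M + 1) ^ d < 2 ^ M"
  shows "\<exists>p. compressible r A (k_comp d + N * M) (principal B) p \<and> (\<forall>\<^sub>F X in U. \<forall>a\<in>X. p a = r a b)"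
proof (rule ccontr)
  assume no: "\<not> ?thesis"
  define q where "q = (\<lambda>a. r a b)"
  define F where "F = generic_filter r q U (principal B)"
  define S where "S Xs I c \<longleftrightarrow> (\<forall>i<length Xs. agree r q (Xs ! i) c \<longleftrightarrow> i \<in> I)" for Xs I c
  define Ok where "Ok X \<longleftrightarrow> X \<subseteq> A \<and> finite X \<and> card X \<le> N" for X :: "'a set"
  have "j \<le> M \<Longrightarrow> \<exists>Xs. length Xs = j \<and> (\<forall>X\<in>set Xs. Ok X) \<and>
      (\<forall>I\<subseteq>{..<j}. \<exists>\<^sub>F c in F (M - j). S Xs I c)" for j
  proof (induction j)
    case 0
    have "\<exists>\<^sub>F c in F M. True"
      using eventually_generic_filter_base_point[OF U b, of "\<lambda>_. False"] by (auto simp: F_def q_def frequently_def)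
    then show ?case by (simp add: S_def)
  next
    case (Suc j)
    then obtain Xs where Xs: "length Xs = j" "\<forall>X\<in>set Xs. Ok X"
      and fr: "\<And>I. I \<subseteq> {..<j} \<Longrightarrow> \<exists>\<^sub>F c in F (M - j). S Xs I c" by auto
    define m where "m = M - Suc j"
    have m: "M - j = Suc m" "j + Suc m = M" using Suc.prems by (auto simp: m_def)
    have UXs: "\<Union>(set Xs) \<subseteq> A" "finite (\<Union>(set Xs))" "card (\<Union>(set Xs)) \<le> N * j"
      using Xs card_Union_list_le[of Xs N] by (auto simp: Ok_def)
    have *: "\<forall>\<^sub>F X in U. (\<exists>\<^sub>F c in F (Suc m). S Xs I c \<and> \<not> agree r q X c) \<and>
        (\<exists>\<^sub>F c in F m. S Xs I c \<and> agree r q X c)" if I: "I \<subseteq> {..<j}" for I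
    proof (rule eventually_conj)
      \<comment> \<open>Agreement is what the outermost level of \<open>F (Suc m)\<close> provides:
        if it were impossible over \<open>F m\<close> for almost all \<open>X\<close>, the pattern
        would fail eventually in \<open>F (Suc m)\<close>.\<close>
      have "\<exists>\<^sub>F c in F (Suc m). S Xs I c" using fr[OF I] m by simp
      then have "\<not> (\<forall>\<^sub>F X in U. \<forall>\<^sub>F c in F m. agree r q X c \<longrightarrow> \<not> S Xs I c)"
        unfolding F_def frequently_def eventually_generic_filter_Suc .
      then have "\<forall>\<^sub>F X in U. \<not> (\<forall>\<^sub>F c in F m. agree r q X c \<longrightarrow> \<not> S Xs I c)" using ultra by blast
      then show "\<forall>\<^sub>F X in U. \<exists>\<^sub>F c in F m. S Xs I c \<and> agree r q X c"
        by eventually_elim (auto simp: frequently_def elim!: contrapos_nn eventually_mono)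
      \<comment> \<open>Disagreement needs a type: take \<open>p\<close> compressible within the
        pattern. It cannot coincide with \<open>q\<close> on almost all \<open>X\<close>, and its
        consistency with \<open>F'\<close> turns the difference into a parameter.\<close>
      define F' where "F' = inf (F (Suc m)) (principal {c. S Xs I c})"
      have "F' \<noteq> bot" using fr[OF I] m
        by (simp add: F'_def trivial_limit_def eventually_inf_principal frequently_def)
      moreover have "vc_below r A (Suc d) F'"
        by (rule vc_below_mono[OF vc]) (auto simp: F'_def F_def intro: le_infI1 generic_filter_le simp del: generic_filter.simps)
      ultimately obtain p where p: "compressible r A (k_comp d) F' p" using ex_compressible by blast
      have "\<not> (\<forall>\<^sub>F X in U. \<forall>a\<in>X. p a = q a)"
      proof
        assume near: "\<forall>\<^sub>F X in U. \<forall>a\<in>X. p a = q a"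
        \<comment> \<open>The \<open>j\<close> sets already built and the \<open>Suc m\<close>
          generic ones are \<open>M\<close> in total, whence the summand
          \<open>N * M\<close>.\<close>
        have "compressible r A (k_comp d + N * (j + Suc m)) (principal B) p"
        proof (rule compressible_of_generic_filter[OF U ok UXs _ _ near])
          fix c c' p
          assume c: "agree r p (\<Union>(set Xs)) c" "agree r p (\<Union>(set Xs)) c'" "S Xs I c"
          have "agree r q (Xs ! i) c = agree r q (Xs ! i) c'" if "i < length Xs" for i
            using c(1,2) nth_mem[OF that] unfolding agree_def by (metis UnionI)
          then show "S Xs I c'" using c(3) by (simp add: S_def)
        qed (use p in \<open>simp add: F'_def F_def del: generic_filter.simps\<close>)
        then show False using no near m by (auto simp: q_def)
      qed
      then have "\<forall>\<^sub>F X in U. \<not> (\<forall>a\<in>X. p a = q a)" using ultra by blast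
      with ok show "\<forall>\<^sub>F X in U. \<exists>\<^sub>F c in F (Suc m). S Xs I c \<and> \<not> agree r q X c"
      proof eventually_elim
        case (elim X)
        then have "\<exists>\<^sub>F c in F'. agree r p X c" using p unfolding compressible_def by blast
        then have "\<exists>\<^sub>F c in F (Suc m). S Xs I c \<and> agree r p X c"
          by (simp add: F'_def frequently_def eventually_inf_principal)
        then show ?case by (rule frequently_elim1) (use elim(2) in \<open>auto simp: agree_def\<close>)
      qed
    qed
    have "\<forall>\<^sub>F X in U. \<forall>I\<in>Pow {..<j}. (\<exists>\<^sub>F c in F (Suc m). S Xs I c \<and> \<not> agree r q X c) \<and>
        (\<exists>\<^sub>F c in F m. S Xs I c \<and> agree r q X c)"
      by (intro eventually_ball_finite) (use * in auto)
    from eventually_happens[OF eventually_conj[OF this ok]] U obtain X where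
      X: "\<forall>I\<in>Pow {..<j}. (\<exists>\<^sub>F c in F (Suc m). S Xs I c \<and> \<not> agree r q X c) \<and>
        (\<exists>\<^sub>F c in F m. S Xs I c \<and> agree r q X c)" and "Ok X"
      unfolding Ok_def by auto
    have S: "S (Xs @ [X]) I c \<longleftrightarrow> S Xs (I - {j}) c \<and> (agree r q X c \<longleftrightarrow> j \<in> I)" for I c
      using Xs(1) by (auto simp: S_def nth_append less_Suc_eq)
    have "\<exists>\<^sub>F c in F m. S (Xs @ [X]) I c" if I: "I \<subseteq> {..<Suc j}" for I
    proof -
      have I': "I - {j} \<subseteq> {..<j}" using I by auto
      show ?thesis
      proof (cases "j \<in> I")
        case True
        then show ?thesis using X I' by (simp add: S)
      next
        case False
        then have "\<exists>\<^sub>F c in F (Suc m). S (Xs @ [X]) I c" using X I' by (simp add: S)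
        \<comment> \<open>Disagreement was found over the smaller filter, and frequency passes to
          the larger one.\<close>
        then show ?thesis using filter_leD[OF generic_filter_Suc_le] unfolding F_def frequently_def by blast
      qed
    qed
    then show ?case using Xs \<open>Ok X\<close> by (intro exI[of _ "Xs @ [X]"]) (auto simp: m_def)
  qed
  from this[of M] obtain Xs where Xs: "length Xs = M" "\<forall>X\<in>set Xs. Ok X"
    and fr: "\<And>I. I \<subseteq> {..<M} \<Longrightarrow> \<exists>\<^sub>F c in F 0. S Xs I c" by auto
  have "\<exists>c\<in>B. S Xs I c" if "I \<subseteq> {..<M}" for I
    using fr[OF that] by (auto simp: F_def frequently_def eventually_principal)
  then obtain f where f: "\<And>I. I \<subseteq> {..<M} \<Longrightarrow> f I \<in> B" "\<And>I. I \<subseteq> {..<M} \<Longrightarrow> S Xs I (f I)"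
    by metis
  define P where "P = \<Union>(set Xs)"
  have P: "P \<subseteq> A" "finite P" "card P \<le> N * M"
    using Xs card_Union_list_le[of Xs N] by (auto simp: P_def Ok_def)
  let ?t = "\<lambda>c. {a\<in>P. r a c}"
  have "inj_on (\<lambda>I. ?t (f I)) (Pow {..<M})"
  proof (rule inj_onI)
    fix I J assume IJ: "I \<in> Pow {..<M}" "J \<in> Pow {..<M}" "?t (f I) = ?t (f J)"
    have "i \<in> I \<longleftrightarrow> i \<in> J" if "i < M" for i
    proof -
      have "Xs ! i \<subseteq> P" using that Xs(1) unfolding P_def by (intro Union_upper nth_mem) simp
      then have "agree r q (Xs ! i) (f I) = agree r q (Xs ! i) (f J)"
        using IJ(3) unfolding agree_def by blast
      then show ?thesis using f(2)[of I] f(2)[of J] IJ(1,2) that Xs(1) by (auto simp: S_def)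
    qed
    then show "I = J" using IJ(1,2) by blast
  qed
  then have "2 ^ M = card ((\<lambda>I. ?t (f I)) ` Pow {..<M})" by (simp add: card_image card_Pow)
  also have "\<dots> \<le> card (?t ` B)"
  proof (rule card_mono)
    have "?t ` B \<subseteq> Pow P" by auto
    then show "finite (?t ` B)" using P(2) finite_subset by blast
    show "(\<lambda>I. ?t (f I)) ` Pow {..<M} \<subseteq> ?t ` B"
    proof (rule image_subsetI)
      fix I assume "I \<in> Pow {..<M}"
      then have "f I \<in> B" using f(1) by simp
      then show "?t (f I) \<in> ?t ` B" by (rule imageI)
    qed
  qed
  also have "\<dots> \<le> (card P + 1) ^ d" by (rule card_traces_le[OF vc P(2,1)])
  also have "\<dots> \<le> (N * M + 1) ^ d" using P(3) by (intro power_mono) auto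
  finally show False using M by simp
qed

section \<open>Majorities of compressible types\<close>

lemma shatters_subset:
  assumes "shatters \<F> S" "T \<subseteq> S"
  shows "shatters \<F> T"
  unfolding shatters_def
proof (intro equalityI subsetI)
  fix R assume "R \<in> Pow T"
  then have "R \<in> (\<lambda>F. F \<inter> S) ` \<F>" using assms unfolding shatters_def by auto
  then obtain F where "F \<in> \<F>" "R = F \<inter> S" by blast
  then have "F \<in> \<F>" "R = F \<inter> T" using \<open>R \<in> Pow T\<close> assms(2) by auto
  then show "R \<in> (\<lambda>F. F \<inter> T) ` \<F>" by blast
qed auto

lemma vc_dim_less:
  assumes "q > 0" and "\<And>S. S \<subseteq> X \<Longrightarrow> finite S \<Longrightarrow> card S = q \<Longrightarrow> \<not> shatters \<F> S"
  shows "vc_dim X \<F> < enat q"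
proof -
  have "vc_dim X \<F> \<le> enat (q - 1)"
    unfolding vc_dim_def
  proof (rule SUP_least)
    fix S assume S: "S \<in> {S. S \<subseteq> X \<and> finite S \<and> shatters \<F> S}"
    have "\<not> q \<le> card S"
    proof
      assume "q \<le> card S"
      then obtain T where T: "T \<subseteq> S" "card T = q" "finite T" by (rule obtain_subset_with_card_n)
      then have "\<not> shatters \<F> T" using S by (intro assms(2)) auto
      then show False using S T(1) shatters_subset by blast
    qed
    then show "enat (card S) \<le> enat (q - 1)" by simp
  qed
  also have "\<dots> < enat q" using assms(1) by simp
  finally show ?thesis .
qed

lemma card_shattered_le:
  assumes "finite \<F>" "finite S" "shatters \<F> S"
  shows "2 ^ card S \<le> card \<F>"
  using assms card_image_le[of \<F> "\<lambda>F. F \<inter> S"] by (simp add: shatters_def card_Pow)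

lemma pq_functionD:
  fixes X :: "nat set"
  assumes "pq_function N" "q \<le> p" "finite X" "\<F> \<subseteq> Pow X" "{} \<notin> \<F>"
    and "vc_dim \<F> ((\<lambda>x. {s\<in>\<F>. x \<in> s}) ` X) < enat q"
    and "\<forall>S\<subseteq>\<F>. card S \<ge> p \<longrightarrow> (\<exists>S\<^sub>0\<subseteq>S. card S\<^sub>0 \<ge> q \<and> (\<exists>x\<in>X. \<forall>s\<in>S\<^sub>0. x \<in> s))"
  shows "\<exists>X\<^sub>0\<subseteq>X. card X\<^sub>0 \<le> N p q \<and> (\<forall>s\<in>\<F>. X\<^sub>0 \<inter> s \<noteq> {})"
  by (rule assms(1)[unfolded pq_function_def, THEN spec, THEN spec, THEN spec, THEN spec, THEN mp])
    (intro conjI assms(2-))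

text \<open>\<open>k_sd\<close> has a separate clause for the first argument \<open>1\<close>, which
  must be excluded. Two disjoint singletons have no one-point transversal; two members never form a
  family of size \<open>p\<close>, and two dual traces shatter no pair.\<close>

lemma pq_function_ge_2:
  assumes "pq_function N" "2 \<le> q" "q \<le> p" "3 \<le> p"
  shows "2 \<le> N p q"
proof -
  let ?X = "{0, 1 :: nat}" and ?F = "{{0}, {1 :: nat}}"
  have vcd: "vc_dim ?F ((\<lambda>x. {s\<in>?F. x \<in> s}) ` ?X) < enat q"
  proof (rule vc_dim_less)
    fix S :: "nat set set" assume S: "finite S" "card S = q"
    show "\<not> shatters ((\<lambda>x. {s\<in>?F. x \<in> s}) ` ?X) S"
    proof
      assume "shatters ((\<lambda>x. {s\<in>?F. x \<in> s}) ` ?X) S"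
      then have "2 ^ card S \<le> card ((\<lambda>x. {s\<in>?F. x \<in> s}) ` ?X)"
        using S(1) by (intro card_shattered_le) auto
      also have "\<dots> \<le> card ?X" by (rule card_image_le) simp
      finally have "(2 :: nat) ^ q \<le> 2 ^ 1" using S(2) by simp
      then have "q \<le> 1" by (rule power_le_imp_le_exp[rotated]) simp
      then show False using assms(2) by simp
    qed
  qed (use assms(2) in simp)
  have "\<not> p \<le> card S" if "S \<subseteq> ?F" for S
    using card_mono[OF _ that] assms(4) by simp
  then have "\<forall>S\<subseteq>?F. card S \<ge> p \<longrightarrow> (\<exists>S\<^sub>0\<subseteq>S. card S\<^sub>0 \<ge> q \<and> (\<exists>x\<in>?X. \<forall>s\<in>S\<^sub>0. x \<in> s))" by blast
  from pq_functionD[OF assms(1,3) _ _ _ vcd this]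
  have "\<exists>X\<^sub>0\<subseteq>?X. card X\<^sub>0 \<le> N p q \<and> (\<forall>s\<in>?F. X\<^sub>0 \<inter> s \<noteq> {})" by simp
  then obtain X\<^sub>0 where X0: "X\<^sub>0 \<subseteq> ?X" "card X\<^sub>0 \<le> N p q" "0 \<in> X\<^sub>0" "1 \<in> X\<^sub>0" by auto
  then have "X\<^sub>0 = ?X" by auto
  then show ?thesis using X0(2) by simp
qed

text \<open>An injection of the finite ground set into \<open>nat\<close> transports the theorem.
  Families of exactly \<open>q\<close> or \<open>p\<close> members suffice in the hypotheses:
  shattering is hereditary, and larger families are cut down.\<close>

lemma pq_function_finite:
  fixes X :: "'a set"
  assumes N: "pq_function N" and "0 < q" "q \<le> p" and X: "finite X" and F: "\<F> \<subseteq> Pow X" "{} \<notin> \<F>"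
    and dual: "\<And>S. S \<subseteq> \<F> \<Longrightarrow> card S = q \<Longrightarrow> \<exists>T\<subseteq>S. \<forall>x\<in>X. {s\<in>S. x \<in> s} \<noteq> T"
    and pq: "\<And>S. S \<subseteq> \<F> \<Longrightarrow> card S = p \<Longrightarrow> \<exists>S\<^sub>0\<subseteq>S. card S\<^sub>0 \<ge> q \<and> (\<exists>x\<in>X. \<forall>s\<in>S\<^sub>0. x \<in> s)"
  obtains X\<^sub>0 where "X\<^sub>0 \<subseteq> X" "card X\<^sub>0 \<le> N p q" "\<forall>s\<in>\<F>. X\<^sub>0 \<inter> s \<noteq> {}"
proof -
  obtain h :: "'a \<Rightarrow> nat" where h: "inj_on h X"
    using X finite_imp_inj_to_nat_seg by metis
  let ?F = "image h ` \<F>"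
  have mem: "h x \<in> h ` s \<longleftrightarrow> x \<in> s" if "x \<in> X" "s \<in> \<F>" for x s
    using h that F(1) by (auto dest: inj_onD)
  have inj: "inj_on (image h) \<F>"
    using inj_on_image_Pow[OF h] F(1) by (rule inj_on_subset)
  have lift: "\<exists>S. S \<subseteq> \<F> \<and> S' = image h ` S \<and> card S = card S'" if "S' \<subseteq> ?F" for S'
    using that inj by (metis card_image subset_image_inj inj_on_subset)
  have vcd: "vc_dim ?F ((\<lambda>x. {s\<in>?F. x \<in> s}) ` (h ` X)) < enat q"
  proof (rule vc_dim_less[OF \<open>0 < q\<close>])
    fix S' assume S': "S' \<subseteq> ?F" "finite S'" "card S' = q"
    then obtain S where S: "S \<subseteq> \<F>" "S' = image h ` S" "card S = q" using lift by metis
    obtain T where T: "T \<subseteq> S" "\<forall>x\<in>X. {s\<in>S. x \<in> s} \<noteq> T" using dual[OF S(1,3)] by blast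
    show "\<not> shatters ((\<lambda>x. {s\<in>?F. x \<in> s}) ` (h ` X)) S'"
    proof
      assume "shatters ((\<lambda>x. {s\<in>?F. x \<in> s}) ` (h ` X)) S'"
      moreover have "image h ` T \<in> Pow S'" using T(1) S(2) by auto
      ultimately have "image h ` T \<in> (\<lambda>F. F \<inter> S') ` ((\<lambda>x. {s\<in>?F. x \<in> s}) ` (h ` X))"
        unfolding shatters_def by simp
      then obtain x where x: "x \<in> X" "image h ` T = {s\<in>?F. h x \<in> s} \<inter> S'" by auto
      have "{s\<in>S. x \<in> s} = T"
      proof (intro equalityI subsetI)
        fix s assume "s \<in> {s\<in>S. x \<in> s}"
        then have "h ` s \<in> image h ` T" using S x by auto
        then obtain t where t: "t \<in> T" "h ` s = h ` t" by blast
        then have "s = t" using inj_onD[OF inj t(2)] \<open>s \<in> {s\<in>S. x \<in> s}\<close> S(1) T(1) by auto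
        then show "s \<in> T" using t(1) by simp
      next
        fix s assume s: "s \<in> T"
        then have "h ` s \<in> {s\<in>?F. h x \<in> s} \<inter> S'" using x(2) by blast
        then have "h x \<in> h ` s" by simp
        then show "s \<in> {s\<in>S. x \<in> s}" using s T(1) S(1) x(1) mem by blast
      qed
      then show False using T(2) x(1) by blast
    qed
  qed
  have "\<exists>S\<^sub>0\<subseteq>S'. q \<le> card S\<^sub>0 \<and> (\<exists>x\<in>h ` X. \<forall>s\<in>S\<^sub>0. x \<in> s)" if S': "S' \<subseteq> ?F" "p \<le> card S'" for S'
  proof -
    obtain S'' where S'': "S'' \<subseteq> S'" "card S'' = p" "finite S''" using obtain_subset_with_card_n[OF S'(2)] by blast
    then obtain S where S: "S \<subseteq> \<F>" "S'' = image h ` S" "card S = p" using lift S'(1) by (metis order_trans)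
    obtain S\<^sub>0 x where S0: "S\<^sub>0 \<subseteq> S" "q \<le> card S\<^sub>0" "x \<in> X" "\<forall>s\<in>S\<^sub>0. x \<in> s" using pq[OF S(1,3)] by blast
    have "card (image h ` S\<^sub>0) = card S\<^sub>0"
      using inj S0(1) S(1) by (intro card_image) (auto intro: inj_on_subset)
    then have "q \<le> card (image h ` S\<^sub>0)" using S0(2) by simp
    moreover have "image h ` S\<^sub>0 \<subseteq> S'" using image_mono[OF S0(1), of "image h"] S(2) S''(1) by simp
    moreover have "\<forall>s\<in>image h ` S\<^sub>0. h x \<in> s" using S0(4) by blast
    moreover have "h x \<in> h ` X" using S0(3) by simp
    ultimately show ?thesis by blast
  qed
  then have "\<forall>S'\<subseteq>?F. p \<le> card S' \<longrightarrow> (\<exists>S\<^sub>0\<subseteq>S'. q \<le> card S\<^sub>0 \<and> (\<exists>x\<in>h ` X. \<forall>s\<in>S\<^sub>0. x \<in> s))"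
    by (intro allI impI)
  moreover have "finite (h ` X)" "?F \<subseteq> Pow (h ` X)" "{} \<notin> ?F" using X F by auto
  ultimately have "\<exists>X\<^sub>0\<subseteq>h ` X. card X\<^sub>0 \<le> N p q \<and> (\<forall>s\<in>?F. X\<^sub>0 \<inter> s \<noteq> {})"
    by (intro pq_functionD[OF N assms(3) _ _ _ vcd])
  then obtain Y where Y: "Y \<subseteq> h ` X" "card Y \<le> N p q" "\<forall>s\<in>?F. Y \<inter> s \<noteq> {}"
    by (elim exE conjE)
  then obtain X\<^sub>0 where X0: "X\<^sub>0 \<subseteq> X" "Y = h ` X\<^sub>0" "inj_on h X\<^sub>0" by (metis subset_image_inj)
  have "card X\<^sub>0 \<le> N p q" using X0 Y(2) card_image by metis
  moreover have "X\<^sub>0 \<inter> s \<noteq> {}" if "s \<in> \<F>" for s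
  proof -
    have "Y \<inter> h ` s \<noteq> {}" using Y(3) that by blast
    then obtain x where "x \<in> X\<^sub>0" "h x \<in> h ` s" using X0(2) by auto
    then show ?thesis using mem[OF _ that] X0(1) by blast
  qed
  ultimately show ?thesis using X0(1) by (intro that[of X\<^sub>0] ballI)
qed

section \<open>Disagreement sets of compressible types\<close>

lemma compressible_mono: "compressible r A k F p \<Longrightarrow> k \<le> k' \<Longrightarrow> compressible r A k' F p"
  unfolding compressible_def by (meson order_trans)

text \<open>The usual bound on the dual VC-dimension. Code \<open>2 ^ Suc d\<close> dually shattered
  sets by the subsets of \<open>{..<Suc d}\<close>; there is then one point for each coordinate, and
  the types behind the sets realise all patterns on these points. Comparison with the fixed
  \<open>q\<close> only flips patterns.\<close>

lemma disagreement_dual_vc: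
  assumes vc: "vc_below r A (Suc d) (principal B)" and X: "X \<subseteq> A"
    and Q: "\<And>p A\<^sub>0. p \<in> Q \<Longrightarrow> finite A\<^sub>0 \<Longrightarrow> A\<^sub>0 \<subseteq> A \<Longrightarrow> \<exists>c\<in>B. agree r p A\<^sub>0 c"
    and S: "S \<subseteq> (\<lambda>p. {a\<in>X. p a \<noteq> q a}) ` Q" "card S = 2 ^ Suc d"
  shows "\<exists>T\<subseteq>S. \<forall>x\<in>X. {s\<in>S. x \<in> s} \<noteq> T"
proof (rule ccontr)
  assume "\<not> ?thesis"
  then have ex: "\<exists>x\<in>X. {s\<in>S. x \<in> s} = T" if "T \<subseteq> S" for T using that by blast
  have "finite S" using S(2) by (simp add: card_ge_0_finite)
  then obtain e where e: "bij_betw e S (Pow {..<Suc d})"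
    using finite_same_card_bij[of S "Pow {..<Suc d}"] S(2) by (auto simp: card_Pow)
  have "\<exists>x\<in>X. \<forall>s\<in>S. x \<in> s \<longleftrightarrow> j \<in> e s" for j
    using ex[of "{s\<in>S. j \<in> e s}"] by blast
  then obtain x where x: "\<And>j. x j \<in> X" "\<And>j s. s \<in> S \<Longrightarrow> x j \<in> s \<longleftrightarrow> j \<in> e s" by metis
  have pat: "\<exists>s\<in>S. e s = J" if "J \<subseteq> {..<Suc d}" for J
    using bij_betw_imp_surj_on[OF e] that by (metis PowI imageE)
  have "inj_on x {..<Suc d}"
  proof (rule inj_onI)
    fix i j assume ij: "i \<in> {..<Suc d}" "j \<in> {..<Suc d}" "x i = x j"
    have "{i} \<subseteq> {..<Suc d}" using ij(1) by simp
    then obtain s where s: "s \<in> S" "e s = {i}" using pat by blast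
    have "x i \<in> s" using x(2)[OF s(1), of i] s(2) by simp
    then have "j \<in> e s" using x(2)[OF s(1), of j] ij(3) by simp
    then show "i = j" using s(2) by simp
  qed
  then have Z: "x ` {..<Suc d} \<subseteq> A" "finite (x ` {..<Suc d})" "card (x ` {..<Suc d}) = Suc d"
    using x(1) X by (auto simp: card_image)
  have "\<exists>T\<subseteq>x ` {..<Suc d}. \<forall>c\<in>B. \<not> agree r (\<lambda>a. a \<in> T) (x ` {..<Suc d}) c"
    using vc[unfolded vc_below_principal, rule_format] Z by simp
  then obtain T where T: "\<forall>c\<in>B. \<not> agree r (\<lambda>a. a \<in> T) (x ` {..<Suc d}) c" by blast
  \<comment> \<open>The code lists the coordinates at which the missing pattern \<open>T\<close>
    differs from \<open>q\<close>, so the type behind \<open>s\<close> has pattern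
    \<open>T\<close>.\<close>
  obtain s where s: "s \<in> S" "e s = {j. j < Suc d \<and> (x j \<in> T) \<noteq> q (x j)}"
    using pat[of "{j. j < Suc d \<and> (x j \<in> T) \<noteq> q (x j)}"] by auto
  then obtain p where p: "p \<in> Q" "s = {a\<in>X. p a \<noteq> q a}" using S(1) by blast
  have px: "p (x j) = (x j \<in> T)" if "j < Suc d" for j
    using x(1)[of j] x(2)[OF s(1), of j] s(2) p(2) that by auto
  obtain c where "c \<in> B" "agree r p (x ` {..<Suc d}) c" using Q[OF p(1) Z(2,1)] by blast
  moreover from this(2) have "agree r (\<lambda>a. a \<in> T) (x ` {..<Suc d}) c"
    using px by (auto simp: agree_def)
  ultimately show False using T by blast
qed

text \<open>The competing types are granted \<open>k_comp d + N * M\<close> values, because the type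
  from \<open>ex_compressible_near\<close> that yields the contradiction must be one of
  them.\<close>

theorem ex_majority:
  fixes r :: "'a \<Rightarrow> 'b \<Rightarrow> bool"
  assumes pq: "pq_function Npq" and b: "b \<in> B" and vc: "vc_below r A (Suc d) (principal B)"
    and q: "q = 2 ^ Suc d" and n: "q \<le> n" and N: "N = Npq n q"
    and M: "(N * M + 1) ^ d < 2 ^ M"
  shows "\<exists>P. (\<forall>i<n. compressible r A (k_comp d + N * M) (principal B) (P i)) \<and>
    (\<forall>a\<in>A. card {i. i < n \<and> P i a \<noteq> r a b} < q)"
proof (rule ccontr)
  define K where "K = k_comp d + N * M"
  define Cp where "Cp = {p. compressible r A K (principal B) p}"
  assume nt: "\<not> ?thesis"
  have bad: "\<exists>a\<in>A. q \<le> card {i. i < n \<and> P i a \<noteq> r a b}" if "\<And>i. i < n \<Longrightarrow> P i \<in> Cp" for P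
  proof (rule ccontr)
    assume no: "\<not> (\<exists>a\<in>A. q \<le> card {i. i < n \<and> P i a \<noteq> r a b})"
    have "\<forall>i<n. compressible r A (k_comp d + N * M) (principal B) (P i)"
      using that by (simp add: Cp_def K_def)
    moreover have "\<forall>a\<in>A. card {i. i < n \<and> P i a \<noteq> r a b} < q" using no by (simp add: not_le)
    ultimately show False using nt by blast
  qed
  have cons: "\<exists>c\<in>B. agree r p A\<^sub>0 c" if "p \<in> Cp" "finite A\<^sub>0" "A\<^sub>0 \<subseteq> A" for p A\<^sub>0
    using that unfolding Cp_def compressible_def by (auto simp: frequently_def eventually_principal)
  have q0: "0 < q" by (simp add: q)
  define V where "V p = {X. X \<subseteq> A \<and> finite X \<and> card X \<le> N \<and> (\<exists>a\<in>X. p a \<noteq> r a b)}" for p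
  have trans: "\<Inter>(V ` Q) \<noteq> {}" if Q: "finite Q" "Q \<subseteq> Cp" "Q \<noteq> {}" for Q
  proof -
    let ?E = "{..<n} \<rightarrow>\<^sub>E Q"
    have "\<forall>P\<in>?E. \<exists>a\<in>A. q \<le> card {i. i < n \<and> P i a \<noteq> r a b}"
      using Q(2) by (intro ballI bad) auto
    then have "\<forall>P. \<exists>a. P \<in> ?E \<longrightarrow> a \<in> A \<and> q \<le> card {i. i < n \<and> P i a \<noteq> r a b}" by blast
    from choice[OF this] obtain f where f: "\<And>P. P \<in> ?E \<Longrightarrow> f P \<in> A"
      "\<And>P. P \<in> ?E \<Longrightarrow> q \<le> card {i. i < n \<and> P i (f P) \<noteq> r (f P) b}" by blast
    \<comment> \<open>One bad point for each \<open>n\<close>-tuple from \<open>Q\<close> keeps the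
      ground set finite and still gives the (p,q)-property.\<close>
    define X where "X = f ` ?E"
    have X: "finite X" "X \<subseteq> A" using f(1) Q(1) by (auto simp: X_def intro!: finite_PiE)
    define s where "s p = {a\<in>X. p a \<noteq> r a b}" for p
    have "s p \<noteq> {}" if "p \<in> Q" for p
    proof -
      \<comment> \<open>The constant tuple shows that \<open>p\<close> itself errs somewhere on
        \<open>X\<close>.\<close>
      let ?P = "\<lambda>i\<in>{..<n}. p"
      have P: "?P \<in> ?E" using that by auto
      have "{i. i < n \<and> ?P i (f ?P) \<noteq> r (f ?P) b} \<noteq> {}"
        using f(2)[OF P] q0 by (metis card.empty not_le)
      then have "p (f ?P) \<noteq> r (f ?P) b" by auto
      moreover have "f ?P \<in> X" unfolding X_def using P by (rule imageI)
      ultimately show ?thesis unfolding s_def by blast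
    qed
    then have ne: "{} \<notin> s ` Q" by auto
    have dual: "\<exists>T\<subseteq>S. \<forall>x\<in>X. {t\<in>S. x \<in> t} \<noteq> T" if "S \<subseteq> s ` Q" "card S = q" for S
      using disagreement_dual_vc[OF vc X(2), of Q S "\<lambda>a. r a b"] cons Q(2) that
      unfolding s_def q by blast
    have np: "\<exists>S\<^sub>0\<subseteq>S. q \<le> card S\<^sub>0 \<and> (\<exists>x\<in>X. \<forall>t\<in>S\<^sub>0. x \<in> t)" if S: "S \<subseteq> s ` Q" "card S = n" for S
    proof -
      have "finite S" using S(2) n q0 by (intro card_ge_0_finite) simp
      then obtain g where g: "bij_betw g {0..<n} S" using ex_bij_betw_nat_finite S(2) by blast
      have "\<forall>i<n. \<exists>p\<in>Q. g i = s p" using g S(1) unfolding bij_betw_def by fastforce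
      then obtain P0 where P0: "\<And>i. i < n \<Longrightarrow> P0 i \<in> Q" "\<And>i. i < n \<Longrightarrow> g i = s (P0 i)" by metis
      let ?P = "restrict P0 {..<n}"
      have P: "?P \<in> ?E" using P0(1) by auto
      \<comment> \<open>\<open>g\<close> has no repetitions, so \<open>q\<close> erring indices give
        \<open>q\<close> different sets through the bad point.\<close>
      let ?I = "{i. i < n \<and> ?P i (f ?P) \<noteq> r (f ?P) b}"
      have "?I \<subseteq> {0..<n}" by auto
      with bij_betw_imp_inj_on[OF g] have "inj_on g ?I" by (rule inj_on_subset)
      then have "card (g ` ?I) = card ?I" by (rule card_image)
      then have "q \<le> card (g ` ?I)" using f(2)[OF P] by simp
      moreover have "g ` ?I \<subseteq> S" using g by (auto simp: bij_betw_def)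
      moreover have "f ?P \<in> X" using P by (auto simp: X_def)
      moreover have "\<forall>t\<in>g ` ?I. f ?P \<in> t" using P0(2) \<open>f ?P \<in> X\<close> by (auto simp: s_def)
      ultimately show ?thesis by blast
    qed
    have sQ: "s ` Q \<subseteq> Pow X" by (auto simp: s_def)
    obtain X\<^sub>0 where X0: "X\<^sub>0 \<subseteq> X" "card X\<^sub>0 \<le> N" "\<forall>t\<in>s ` Q. X\<^sub>0 \<inter> t \<noteq> {}"
      unfolding N by (rule pq_function_finite[OF pq q0 n X(1) sQ ne dual np])
    have "X\<^sub>0 \<in> V p" if "p \<in> Q" for p
    proof -
      have "X\<^sub>0 \<inter> s p \<noteq> {}" using X0(3) that by blast
      then show ?thesis using X X0(1,2) finite_subset[OF X0(1) X(1)] by (auto simp: V_def s_def)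
    qed
    then show ?thesis by blast
  qed
  have "(INF p\<in>Cp. principal (V p)) \<noteq> bot"
  proof (rule INF_filter_not_bot)
    fix Q assume Q: "Q \<subseteq> Cp" "finite Q"
    show "(INF p\<in>Q. principal (V p)) \<noteq> bot"
    proof (cases "Q = {}")
      case False
      then show ?thesis using trans[OF Q(2,1)] by (simp add: INF_principal_finite[OF Q(2)] principal_eq_bot_iff)
    qed (simp add: trivial_limit_def eventually_top)
  qed
  then obtain U where U: "U \<le> (INF p\<in>Cp. principal (V p))" "U \<noteq> bot"
    "\<And>P. eventually P U \<or> (\<forall>\<^sub>F X in U. \<not> P X)" by (rule ex_ultrafilter) blast
  have V: "\<forall>\<^sub>F X in U. X \<in> V p" if "p \<in> Cp" for p
    using order_trans[OF U(1) INF_lower[OF that]] by (simp add: le_principal)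
  have "principal B \<noteq> bot" using b by (auto simp: principal_eq_bot_iff)
  \<comment> \<open>One compressible type is needed to see that \<open>U\<close> concentrates on
    subsets of \<open>A\<close> with at most \<open>N\<close> elements.\<close>
  then obtain p0 where "compressible r A (k_comp d) (principal B) p0" using ex_compressible[OF _ vc] by blast
  then have p0: "p0 \<in> Cp" unfolding Cp_def K_def by (simp add: compressible_mono)
  have ok: "\<forall>\<^sub>F X in U. X \<subseteq> A \<and> finite X \<and> card X \<le> N"
    by (rule eventually_mono[OF V[OF p0]]) (simp add: V_def)
  obtain p where p: "p \<in> Cp" "\<forall>\<^sub>F X in U. \<forall>a\<in>X. p a = r a b"
    using ex_compressible_near[OF U(2,3) ok b vc M] unfolding Cp_def K_def by blast
  have "\<forall>\<^sub>F X in U. False" using p(2) V[OF p(1)] by eventually_elim (auto simp: V_def)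
  then show False using U(2) by (simp add: trivial_limit_def)
qed

section \<open>The numerical bounds\<close>

lemma choose_upto_le: "choose_upto s k \<le> (s + 1) ^ k"
proof -
  have "choose_upto s k = (\<Sum>i\<le>k. card {S. S \<subseteq> {..<s} \<and> card S = i})"
    by (simp add: choose_upto_def n_subsets)
  also have "\<dots> = card (\<Union>i\<in>{..k}. {S. S \<subseteq> {..<s} \<and> card S = i})"
    by (rule card_UN_disjoint[symmetric]) auto
  also have "(\<Union>i\<in>{..k}. {S. S \<subseteq> {..<s} \<and> card S = i}) = {S. S \<subseteq> {..<s} \<and> card S \<le> k}" by auto
  also have "card \<dots> \<le> (s + 1) ^ k" using card_subsets_le[of "{..<s}" k] by simp
  finally show ?thesis .
qed

text \<open>\<open>B_vc\<close> is a \<open>Max\<close>, which is meaningful only for a finite set;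
  a polynomial in \<open>s\<close> loses against \<open>2 ^ s\<close>.\<close>

lemma finite_B_vc_set: "finite {s. choose_upto s k ^ n \<ge> 2 ^ s}"
proof -
  define m where "m = k * n"
  have "filterlim (\<lambda>s. real s * ln 2) at_top sequentially"
    by (rule filterlim_at_top_mult_tendsto_pos[OF tendsto_const _ filterlim_real_sequentially, of "ln 2"]) simp
  then have "(\<lambda>s. (real s * ln 2) ^ m / exp (real s * ln 2)) \<longlonglongrightarrow> 0"
    by (rule filterlim_compose[OF tendsto_power_div_exp_0])
  then have "(\<lambda>s. (2 / ln 2 ^ m) * ((real s * ln 2) ^ m / exp (real s * ln 2))) \<longlonglongrightarrow> 0"
    by (rule tendsto_mult_right_zero)
  moreover have "(2 / ln 2 ^ m) * ((real s * ln 2) ^ m / exp (real s * ln 2)) = 2 * real s ^ m / 2 ^ s" for s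
    by (simp add: power_mult_distrib exp_of_nat_mult)
  ultimately have "(\<lambda>s. 2 * real s ^ m / 2 ^ s) \<longlonglongrightarrow> 0" by simp
  \<comment> \<open>The shift puts \<open>s + 1\<close> into the numerator; the factor
    \<open>2\<close> cancels the extra power of two in \<open>2 ^ Suc s\<close>.\<close>
  from LIMSEQ_Suc[OF this] have "\<forall>\<^sub>F s in sequentially. 2 * real (Suc s) ^ m / 2 ^ Suc s < 1"
    by (rule order_tendstoD) simp
  then obtain s0 where s0: "\<And>s. s \<ge> s0 \<Longrightarrow> real (Suc s) ^ m / 2 ^ s < 1"
    by (auto simp: eventually_sequentially)
  have "s < s0" if "choose_upto s k ^ n \<ge> 2 ^ s" for s
  proof (rule ccontr)
    assume "\<not> s < s0"
    then have "(real s + 1) ^ (k * n) < 2 ^ s" using s0[of s] by (simp add: divide_simps m_def add.commute)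
    then have "real ((s + 1) ^ (k * n)) < real (2 ^ s)" by (simp add: add.commute)
    then have "(s + 1) ^ (k * n) < 2 ^ s" unfolding of_nat_less_iff .
    moreover have "choose_upto s k ^ n \<le> ((s + 1) ^ k) ^ n" by (intro power_mono choose_upto_le) simp
    ultimately show False using that by (simp add: power_mult)
  qed
  then have "{s. choose_upto s k ^ n \<ge> 2 ^ s} \<subseteq> {..<s0}" by auto
  then show ?thesis using finite_subset by blast
qed

lemma B_vc_geI: "choose_upto s k ^ n \<ge> 2 ^ s \<Longrightarrow> s \<le> B_vc n k"
  unfolding B_vc_def using finite_B_vc_set by (intro Max_ge) auto

lemma B_vc_ge_left:
  assumes "1 \<le> k" "1 \<le> n"
  shows "n \<le> B_vc n k"
proof (rule B_vc_geI)
  have "(\<Sum>i\<in>{0,1}. n choose i) \<le> choose_upto n k"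
    unfolding choose_upto_def using assms by (intro sum_mono2) auto
  then show "2 ^ n \<le> choose_upto n k ^ n" using assms by (intro power_mono) auto
qed

lemma B_vc_ge_right:
  assumes "1 \<le> n"
  shows "k \<le> B_vc n k"
proof (rule B_vc_geI)
  have "choose_upto k k = 2 ^ k" unfolding choose_upto_def by (rule choose_row_sum)
  then show "2 ^ k \<le> choose_upto k k ^ n" using assms by (simp add: self_le_power)
qed

lemma k_comp_mono: "d \<le> d' \<Longrightarrow> k_comp d \<le> k_comp d'"
  by (rule lift_Suc_mono_le[of k_comp]) (simp_all add: k_comp_Suc)

lemma square_less_power: "(Suc B) * B < 2 ^ Suc B"
proof (induction B)
  case (Suc B)
  show ?case
  proof (cases "B < 2")
    case True
    then have "B = 0 \<or> B = 1" by auto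
    then show ?thesis by auto
  next
    case False
    have "Suc (Suc B) * Suc B = Suc B * B + 2 * Suc B" by simp
    also have "2 * Suc B \<le> Suc B * B"
      using False mult_le_mono2[of 2 B "Suc B"] by (simp only: mult.commute[of 2] not_less)
    finally show ?thesis using Suc.IH by simp
  qed
qed simp

text \<open>\<open>M\<close> is the argument at which \<open>k_sd\<close> evaluates
  \<open>k_sd_one\<close>. By \<open>N \<le> B\<close> the base \<open>N * M + 1\<close> is at most
  \<open>M * M\<close>, and by \<open>2 ^ (d + 1) \<le> B\<close> the resulting exponent
  \<open>2 * (B + 1) * d\<close> stays below \<open>M\<close>. The summand \<open>2 * M\<close> of
  \<open>k_sd_one M\<close> pays for \<open>N * M\<close>.\<close>

lemma k_sd_bounds:
  assumes N: "2 \<le> N"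
  obtains M where "(N * M + 1) ^ d < 2 ^ M" "k_comp d + N * M \<le> k_sd N d"
proof -
  define B where "B = B_vc N (2 ^ (d + 1))"
  define M where "M = (2 :: nat) ^ (B + 1)"
  have B: "N \<le> B" "2 ^ (d + 1) \<le> B" unfolding B_def using N by (simp_all add: B_vc_ge_left B_vc_ge_right)
  have d: "d < 2 ^ d" by simp
  have dB: "2 * d < B" "d \<le> M" using B(2) d less_exp[of "B + 1"] unfolding M_def by (simp_all, linarith+)
  have "N * M + 1 \<le> B * M + M" using B(1) by (intro add_mono mult_right_mono) (auto simp: M_def)
  also have "\<dots> = (B + 1) * M" by simp
  also have "\<dots> \<le> M * M" using less_exp[of "B + 1"] by (intro mult_right_mono) (auto simp: M_def)
  also have "\<dots> = 2 ^ (2 * (B + 1))" by (simp add: M_def power_add[symmetric])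
  finally have "(N * M + 1) ^ d \<le> (2 ^ (2 * (B + 1))) ^ d" by (intro power_mono) auto
  also have "\<dots> = 2 ^ (2 * (B + 1) * d)" by (rule power_mult[symmetric])
  also have "\<dots> < 2 ^ M"
  proof (rule power_strict_increasing)
    have "2 * (B + 1) * d = Suc B * (2 * d)" by simp
    also have "\<dots> \<le> Suc B * B" using dB by (intro mult_left_mono) auto
    also have "\<dots> < M" using square_less_power by (simp add: M_def)
    finally show "2 * (B + 1) * d < M" .
  qed simp
  finally have 1: "(N * M + 1) ^ d < 2 ^ M" .
  have "k_comp d + N * M \<le> N * k_comp M + N * M"
  proof (rule add_right_mono)
    have "k_comp d \<le> k_comp M" by (rule k_comp_mono[OF dB(2)])
    also have "\<dots> \<le> N * k_comp M" using N by simp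
    finally show "k_comp d \<le> N * k_comp M" .
  qed
  also have "\<dots> \<le> N * k_sd_one M" unfolding k_sd_one_def by (simp add: distrib_left)
  also have "\<dots> = k_sd N d" using N by (simp add: k_sd_def B_def M_def)
  finally show ?thesis using that 1 by blast
qed

section \<open>Semantics and syntax of the majority formula\<close>

text \<open>With the default \<open>undefined\<close> this is the assignment in
  \<open>holds\<close>; other defaults arise below a block of quantifiers.\<close>

definition assign :: "('v \<Rightarrow> 'u) \<Rightarrow> 'v list \<Rightarrow> 'u list \<Rightarrow> 'v \<Rightarrow> 'u" where
  "assign e vs as v = (case map_of (zip vs as) v of Some a \<Rightarrow> a | None \<Rightarrow> e v)"

lemma assign_Nil [simp]: "assign e [] as = e"
  by (auto simp: assign_def)

lemma assign_Cons: "v \<notin> set vs \<Longrightarrow> assign (e(v := a)) vs as = assign e (v # vs) (a # as)"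
  by (rule ext) (auto simp: assign_def split: option.splits dest!: map_of_SomeD set_zip_leftD)

lemma assign_other: "v \<notin> set vs \<Longrightarrow> assign e vs as v = e v"
  by (auto simp: assign_def split: option.splits dest!: map_of_SomeD set_zip_leftD)

lemma map_assign: "distinct vs \<Longrightarrow> length as = length vs \<Longrightarrow> map (assign e vs as) vs = as"
  by (rule nth_equalityI) (auto simp: assign_def map_of_zip_nth)

lemma map_assign_other: "set vs \<inter> set ws = {} \<Longrightarrow> map (assign e vs as) ws = map e ws"
  by (intro map_cong refl assign_other) auto

section \<open>Truth under assignments and substitutions\<close>

lemma eval_tm_cong: "(\<And>v. v \<in> tm_vars t \<Longrightarrow> e v = e' v) \<Longrightarrow> eval_tm M e t = eval_tm M e' t"
proof (induction t)
  case (Fn f ts)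
  then have "map (eval_tm M e) ts = map (eval_tm M e') ts"
    by (intro map_cong refl Fn.IH) auto
  then show ?case by (simp only: eval_tm.simps)
qed simp

lemma sat_cong: "(\<And>v. v \<in> fv p \<Longrightarrow> e v = e' v) \<Longrightarrow> sat M e p = sat M e' p"
proof (induction p arbitrary: e e')
  case (Eq t u)
  then have "eval_tm M e t = eval_tm M e' t" "eval_tm M e u = eval_tm M e' u"
    by (auto intro!: eval_tm_cong)
  then show ?case by simp
next
  case (Rel r ts)
  then have "map (eval_tm M e) ts = map (eval_tm M e') ts"
    by (auto intro!: eval_tm_cong)
  then show ?case by (simp only: sat.simps)
next
  case (Neg p)
  have "sat M e p = sat M e' p" by (rule Neg.IH) (use Neg.prems in simp)
  then show ?case by simp
next
  case (And p q)
  have "sat M e p = sat M e' p" by (rule And.IH(1)) (use And.prems in simp)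
  moreover have "sat M e q = sat M e' q" by (rule And.IH(2)) (use And.prems in simp)
  ultimately show ?case by simp
next
  case (All v p)
  have "sat M (e(v := a)) p = sat M (e'(v := a)) p" for a
    by (rule All.IH) (use All.prems in auto)
  then show ?case by simp
qed simp

lemma eval_tm_map_tm: "eval_tm M e (map_tm id s t) = eval_tm M (e \<circ> s) t"
  by (induction t) (simp_all cong: map_cong)

text \<open>\<open>subst\<close> does not rename, so capture is excluded by hypothesis: a free
  variable is fixed or sent outside \<open>vars p\<close>, which contains the bound variables
  too.\<close>

lemma sat_subst:
  "(\<And>v. v \<in> fv p \<Longrightarrow> s v = v \<or> s v \<notin> vars p) \<Longrightarrow> sat M e (subst p s) = sat M (e \<circ> s) p"
proof (induction p arbitrary: e s)
  case (Rel r ts)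
  then show ?case by (simp add: eval_tm_map_tm comp_def)
next
  case (And p q)
  have "sat M e (subst p s) = sat M (e \<circ> s) p" using And.prems by (intro And.IH(1)) auto
  moreover have "sat M e (subst q s) = sat M (e \<circ> s) q" using And.prems by (intro And.IH(2)) auto
  ultimately show ?case by (simp only: subst.simps sat.simps)
next
  case (All v p)
  have "sat M (e(v := a)) (subst p (s(v := v))) = sat M ((e \<circ> s)(v := a)) p" for a
  proof -
    have "sat M (e(v := a)) (subst p (s(v := v))) = sat M (e(v := a) \<circ> s(v := v)) p"
      by (rule All.IH) (use All.prems in auto)
    also have "\<dots> = sat M ((e \<circ> s)(v := a)) p"
      by (rule sat_cong) (use All.prems in fastforce)
    finally show ?thesis .
  qed
  then show ?case by (simp only: subst.simps sat.simps)
qed (simp_all add: eval_tm_map_tm)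

lemma sat_Conj [simp]: "sat M e (Conj ps) \<longleftrightarrow> (\<forall>p\<in>set ps. sat M e p)"
  unfolding Conj_def by (induction ps) auto

lemma sat_Disj [simp]: "sat M e (Disj ps) \<longleftrightarrow> (\<exists>p\<in>set ps. sat M e p)"
  unfolding Disj_def by (induction ps) auto

lemma sat_Alls:
  "distinct vs \<Longrightarrow> sat M e (Alls vs p) \<longleftrightarrow> (\<forall>as\<in>tuples M vs. sat M (assign e vs as) p)"
proof (induction vs arbitrary: e)
  case (Cons v vs)
  have "sat M e (Alls (v # vs) p) \<longleftrightarrow>
      (\<forall>a\<in>univ M (sort_of v). \<forall>as\<in>tuples M vs. sat M (assign e (v # vs) (a # as)) p)"
    using Cons by (simp add: Alls_def assign_Cons)
  then show ?case by (auto simp: tuples_def list_all2_Cons2)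
qed (auto simp: tuples_def Alls_def)

lemma sat_Eqs: "length vs = length ws \<Longrightarrow> sat M e (Eqs vs ws) \<longleftrightarrow> map e vs = map e ws"
  by (induction vs ws rule: list_induct2) (simp_all add: Eqs_def)

text \<open>The filtered list is the longest subsequence satisfied by \<open>e\<close>, so its
  length alone decides the disjunction.\<close>

lemma sat_Maj:
  "sat M e (Maj ps) \<longleftrightarrow> 2 * card {i. i < length ps \<and> sat M e (ps ! i)} > length ps"
proof -
  let ?f = "filter (sat M e) ps"
  have "(\<exists>qs. subseq qs ps \<and> 2 * length qs > length ps \<and> (\<forall>q\<in>set qs. sat M e q)) \<longleftrightarrow>
    2 * length ?f > length ps"
  proof
    assume "\<exists>qs. subseq qs ps \<and> 2 * length qs > length ps \<and> (\<forall>q\<in>set qs. sat M e q)"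
    then obtain qs where qs: "subseq qs ps" "2 * length qs > length ps" "\<forall>q\<in>set qs. sat M e q" by blast
    have "subseq (filter (sat M e) qs) ?f" using qs(1) by (rule subseq_filter)
    then have "subseq qs ?f" using qs(3) by simp
    then have "length qs \<le> length ?f" by (rule list_emb_length)
    then show "2 * length ?f > length ps" using qs(2) by simp
  next
    assume "2 * length ?f > length ps"
    then show "\<exists>qs. subseq qs ps \<and> 2 * length qs > length ps \<and> (\<forall>q\<in>set qs. sat M e q)"
      by (intro exI[of _ ?f]) simp
  qed
  moreover have "sat M e (Maj ps) \<longleftrightarrow>
      (\<exists>qs. subseq qs ps \<and> 2 * length qs > length ps \<and> (\<forall>q\<in>set qs. sat M e q))"
  proof -
    have "real (length qs) > real (length ps) / 2 \<longleftrightarrow> 2 * length qs > length ps" for qs :: "('a, 'b, 'c \<times> nat) fm list"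
      by linarith
    then show ?thesis by (auto simp: Maj_def)
  qed
  ultimately show ?thesis by (simp add: length_filter_conv_card)
qed

text \<open>Only the values at \<open>vs\<close> matter; this allows \<phi> to be evaluated under
  the assignment of the whole majority formula, also after a substitution.\<close>

lemma holds_iff_sat:
  assumes "formula_in L p vs" "map e vs = as"
  shows "holds M p vs as \<longleftrightarrow> sat M e p"
proof -
  have "map (assign (\<lambda>_. undefined) vs as) vs = map e vs"
    using assms by (subst map_assign) (auto simp: formula_in_def)
  moreover have "holds M p vs as \<longleftrightarrow> sat M (assign (\<lambda>_. undefined) vs as) p"
    by (simp add: holds_def assign_def[abs_def])
  ultimately show ?thesis using assms(1)
    by (auto simp: formula_in_def intro!: sat_cong)
qed

section \<open>Replacement of variables and blocks of tuples\<close>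

lemma replace_other: "v \<notin> set vs \<Longrightarrow> replace vs ws v = v"
  by (auto simp: replace_def split: option.splits dest!: map_of_SomeD set_zip_leftD)

lemma replace_in: "v \<in> set vs \<Longrightarrow> length ws = length vs \<Longrightarrow> replace vs ws v \<in> set ws"
  by (auto simp: replace_def split: option.splits dest!: map_of_SomeD set_zip_rightD)

lemma map_replace: "distinct vs \<Longrightarrow> length ws = length vs \<Longrightarrow> map (replace vs ws) vs = ws"
  by (rule nth_equalityI) (auto simp: replace_def map_of_zip_nth)

lemma sort_replace:
  assumes "map sort_of ws = map sort_of vs"
  shows "sort_of (replace vs ws v) = sort_of v"
proof (cases "map_of (zip vs ws) v")
  case (Some w)
  then obtain i where "i < length vs" "i < length ws" "vs ! i = v" "ws ! i = w"
    by (auto dest!: map_of_SomeD simp: set_zip)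
  then show ?thesis using Some arg_cong[OF assms, of "\<lambda>l. l ! i"] by (simp add: replace_def)
qed (simp add: replace_def)

lemma length_blocks [simp]: "length (blocks n k z) = n * k"
  by (induction n) (simp_all add: blocks_def)

lemma set_blocks: "set (blocks n k z) = {z i j |i j. i < n \<and> j < k}"
  by (force simp: blocks_def)

lemma map_blocks: "map f (blocks n k z) = blocks n k (\<lambda>i j. f (z i j))"
  by (simp add: blocks_def map_concat comp_def)

lemma blocks_eq_iff: "blocks n k f = blocks n k g \<longleftrightarrow> (\<forall>i<n. \<forall>j<k. f i j = g i j)"
proof (induction n)
  case (Suc n)
  have "blocks (Suc n) k h = blocks n k h @ map (h n) [0..<k]" for h :: "nat \<Rightarrow> nat \<Rightarrow> 'a"
    by (simp add: blocks_def)
  then show ?case using Suc by (auto simp: less_Suc_eq)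
qed (simp add: blocks_def)

text \<open>Disjointness of \<open>y\<close> from the other variables preserves their values under
  the quantifier, and freshness permits substituting \<open>z i j\<close> for \<open>x\<close>. From
  here on only this semantic form of the formula is used.\<close>

lemma holds_maj_formula:
  assumes \<phi>: "formula_in L \<phi> (x @ y)"
    and zs: "zs = blocks n k z @ blocks n k z' @ blocks n k z''"
    and sorted: "sorted_like x zs" and dist: "distinct (x @ y @ concat zs)"
    and fresh: "set (concat zs) \<inter> vars \<phi> = {}"
    and a: "length a = length x"
    and c: "c = blocks n k C @ blocks n k C' @ blocks n k C''" "\<And>t. t \<in> set c \<Longrightarrow> length t = length x"
  shows "holds M (maj_formula n k \<phi> x y z z' z'') (x @ concat zs) (a @ concat c) \<longleftrightarrow>
    2 * card {i. i < n \<and> (\<forall>b\<in>tuples M y.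
      (\<forall>j<k. holds M \<phi> (x @ y) (C i j @ b) \<longleftrightarrow> C' i j = C'' i j) \<longrightarrow> holds M \<phi> (x @ y) (a @ b))} > n"
proof -
  define e where "e = assign (\<lambda>_. undefined) (x @ concat zs) (a @ concat c)"
  have len: "length w = length x" if "w \<in> set zs" for w
    using sorted that by (auto simp: sorted_like_def dest: map_eq_imp_length_eq)
  have "length (concat zs) = length (concat c)"
  proof -
    have "map length zs = map (\<lambda>_. length x) zs" using len by (intro map_cong refl)
    moreover have "map length c = map (\<lambda>_. length x) c" using c(2) by (intro map_cong refl)
    moreover have "length zs = length c" by (simp add: zs c(1))
    ultimately show ?thesis by (simp add: length_concat map_replicate_const)
  qed
  then have "map e (x @ concat zs) = a @ concat c"
    unfolding e_def using dist a by (intro map_assign) auto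
  then have ex: "map e x = a" and "concat (map (map e) zs) = concat c"
    using a by (auto simp: map_concat)
  \<comment> \<open>All tuples have the length of \<open>x\<close>, so the concatenated values can
    be cut back into the members of \<open>c\<close>.\<close>
  then have "map (map e) zs = c"
  proof (intro concat_injective)
    show "\<forall>(s, t)\<in>set (zip (map (map e) zs) c). length s = length t"
    proof clarify
      fix s t assume st: "(s, t) \<in> set (zip (map (map e) zs) c)"
      have "s \<in> set (map (map e) zs)" "t \<in> set c"
        using set_zip_leftD[OF st] set_zip_rightD[OF st] by simp_all
      then show "length s = length t" using len c(2) by auto
    qed
  qed (simp_all add: zs c(1))
  then have ez: "map e (z i j) = C i j" "map e (z' i j) = C' i j" "map e (z'' i j) = C'' i j"
    if "i < n" "j < k" for i j
    using that by (auto simp: zs c(1) map_blocks blocks_eq_iff)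
  have zin: "z i j \<in> set zs" "z' i j \<in> set zs" "z'' i j \<in> set zs" if "i < n" "j < k" for i j
    using that by (auto simp: zs set_blocks)
  have "sat M e (Alls y (Imp (Conj (map (\<lambda>j. Iff (subst \<phi> (replace x (z i j))) (Eqs (z' i j) (z'' i j))) [0..<k])) \<phi>))
     \<longleftrightarrow> (\<forall>b\<in>tuples M y. (\<forall>j<k. holds M \<phi> (x @ y) (C i j @ b) \<longleftrightarrow> C' i j = C'' i j) \<longrightarrow> holds M \<phi> (x @ y) (a @ b))"
    (is "?l \<longleftrightarrow> ?r") if i: "i < n" for i
  proof -
    have "?l \<longleftrightarrow> (\<forall>b\<in>tuples M y. (\<forall>j<k. sat M (assign e y b) (subst \<phi> (replace x (z i j))) \<longleftrightarrow>
        sat M (assign e y b) (Eqs (z' i j) (z'' i j))) \<longrightarrow> sat M (assign e y b) \<phi>)"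
      using dist by (subst sat_Alls) auto
    also have "\<dots> \<longleftrightarrow> ?r"
    proof (rule ball_cong[OF refl])
      fix b assume b: "b \<in> tuples M y"
      define e' where "e' = assign e y b"
      have "length b = length y" using b by (auto simp: tuples_def dest: list_all2_lengthD)
      then have e'y: "map e' y = b" unfolding e'_def using dist by (intro map_assign) auto
      have e'x: "map e' x = a" unfolding e'_def using dist ex by (subst map_assign_other) auto
      have e'z: "map e' w = map e w" if "w \<in> set zs" for w
        unfolding e'_def using dist that by (subst map_assign_other) auto
      have sat_\<phi>: "sat M (assign e y b) \<phi> = holds M \<phi> (x @ y) (a @ b)"
        unfolding e'_def[symmetric] using e'x e'y by (subst holds_iff_sat[OF \<phi>]) auto
      have "(sat M (assign e y b) (subst \<phi> (replace x (z i j))) \<longleftrightarrow> sat M (assign e y b) (Eqs (z' i j) (z'' i j)))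
        \<longleftrightarrow> (holds M \<phi> (x @ y) (C i j @ b) \<longleftrightarrow> C' i j = C'' i j)" if j: "j < k" for j
      proof -
        have lz: "length (z i j) = length x" using len zin[OF i j] by simp
        have "sat M e' (subst \<phi> (replace x (z i j))) = sat M (e' \<circ> replace x (z i j)) \<phi>"
        proof (rule sat_subst)
          fix v
          show "replace x (z i j) v = v \<or> replace x (z i j) v \<notin> vars \<phi>"
          proof (cases "v \<in> set x")
            case True
            then have "replace x (z i j) v \<in> set (concat zs)"
              using replace_in[OF True lz] zin(1)[OF i j] by auto
            then show ?thesis using fresh by blast
          qed (simp add: replace_other)
        qed
        also have "\<dots> = holds M \<phi> (x @ y) (C i j @ b)"
        proof (subst holds_iff_sat[OF \<phi>])
          have "map (e' \<circ> replace x (z i j)) x = map e' (map (replace x (z i j)) x)" by simp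
          also have "\<dots> = C i j"
            using dist lz e'z[OF zin(1)[OF i j]] ez(1)[OF i j] by (subst map_replace) auto
          finally have 1: "map (e' \<circ> replace x (z i j)) x = C i j" .
          have "v \<notin> set x" if "v \<in> set y" for v using dist that by auto
          then have "map (e' \<circ> replace x (z i j)) y = map e' y" by (simp add: replace_other)
          then show "map (e' \<circ> replace x (z i j)) (x @ y) = C i j @ b" using 1 e'y by simp
        qed simp
        finally have 1: "sat M e' (subst \<phi> (replace x (z i j))) = holds M \<phi> (x @ y) (C i j @ b)" .
        have "sat M e' (Eqs (z' i j) (z'' i j)) \<longleftrightarrow> C' i j = C'' i j"
          using len[OF zin(2)[OF i j]] len[OF zin(3)[OF i j]] e'z[OF zin(2)[OF i j]] e'z[OF zin(3)[OF i j]] ez(2,3)[OF i j]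
          by (subst sat_Eqs) auto
        with 1 show ?thesis unfolding e'_def by simp
      qed
      with sat_\<phi> show "((\<forall>j<k. sat M (assign e y b) (subst \<phi> (replace x (z i j))) \<longleftrightarrow>
          sat M (assign e y b) (Eqs (z' i j) (z'' i j))) \<longrightarrow> sat M (assign e y b) \<phi>) \<longleftrightarrow>
        ((\<forall>j<k. holds M \<phi> (x @ y) (C i j @ b) \<longleftrightarrow> C' i j = C'' i j) \<longrightarrow> holds M \<phi> (x @ y) (a @ b))"
        by metis
    qed
    finally show ?thesis .
  qed
  then have "{i. i < n \<and> sat M e (Alls y (Imp (Conj (map (\<lambda>j. Iff (subst \<phi> (replace x (z i j))) (Eqs (z' i j) (z'' i j))) [0..<k])) \<phi>))}
    = {i. i < n \<and> (\<forall>b\<in>tuples M y. (\<forall>j<k. holds M \<phi> (x @ y) (C i j @ b) \<longleftrightarrow> C' i j = C'' i j) \<longrightarrow> holds M \<phi> (x @ y) (a @ b))}"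
    by blast
  moreover have "holds M (maj_formula n k \<phi> x y z z' z'') (x @ concat zs) (a @ concat c) \<longleftrightarrow> sat M e (maj_formula n k \<phi> x y z z' z'')"
    by (simp add: holds_def e_def assign_def[abs_def])
  ultimately show ?thesis
    unfolding maj_formula_def sat_Maj by (simp cong: conj_cong)
qed

section \<open>Well-formedness and free variables\<close>

lemma has_sort_map_tm:
  "(\<And>v. sort_of (s v) = sort_of v) \<Longrightarrow> has_sort L (map_tm id s t) \<sigma> = has_sort L t \<sigma>"
proof (induction t arbitrary: \<sigma>)
  case (Fn f ts)
  then show ?case by (auto simp: list_all2_conv_all_nth)
qed simp

lemma wff_subst: "(\<And>v. sort_of (s v) = sort_of v) \<Longrightarrow> wff L (subst p s) = wff L p"
  by (induction p arbitrary: s) (simp_all add: has_sort_map_tm list_all2_map1)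

lemma tm_vars_map_tm: "tm_vars (map_tm id s t) = s ` tm_vars t"
  by (rule tm.set_map)

lemma fv_subst: "fv (subst p s) \<subseteq> s ` fv p"
proof (induction p arbitrary: s)
  case (All v p)
  have "fv (subst p (s(v := v))) \<subseteq> (s(v := v)) ` fv p" by (rule All.IH)
  then show ?case by auto
qed (fastforce simp: tm_vars_map_tm)+

lemma wff_Conj: "wff L (Conj ps) \<longleftrightarrow> (\<forall>p\<in>set ps. wff L p)"
  unfolding Conj_def by (induction ps) auto

lemma wff_Disj: "wff L (Disj ps) \<longleftrightarrow> (\<forall>p\<in>set ps. wff L p)"
  unfolding Disj_def by (induction ps) auto

lemma wff_Alls: "wff L (Alls vs p) \<longleftrightarrow> wff L p"
  unfolding Alls_def by (induction vs) auto

lemma fv_Conj: "fv (Conj ps) = (\<Union>p\<in>set ps. fv p)"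
  unfolding Conj_def by (induction ps) auto

lemma fv_Disj: "fv (Disj ps) = (\<Union>p\<in>set ps. fv p)"
  unfolding Disj_def by (induction ps) auto

lemma fv_Alls: "fv (Alls vs p) = fv p - set vs"
  unfolding Alls_def by (induction vs) auto

lemma set_subseqs_subset: "qs \<in> set (subseqs ps) \<Longrightarrow> set qs \<subseteq> set ps"
  using subseqs_powset[of ps] by blast

lemma wff_Maj: "(\<And>p. p \<in> set ps \<Longrightarrow> wff L p) \<Longrightarrow> wff L (Maj ps)"
  unfolding Maj_def wff_Disj using set_subseqs_subset by (fastforce simp: wff_Conj simp del: in_set_subseqs)

lemma fv_Maj: "fv (Maj ps) \<subseteq> (\<Union>p\<in>set ps. fv p)"
  unfolding Maj_def fv_Disj using set_subseqs_subset by (fastforce simp: fv_Conj simp del: in_set_subseqs)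

lemma wff_Eqs: "map sort_of vs = map sort_of ws \<Longrightarrow> wff L (Eqs vs ws)"
  by (induction vs ws rule: list_induct2') (simp_all add: Eqs_def wff_Conj)

lemma fv_Eqs: "fv (Eqs vs ws) \<subseteq> set vs \<union> set ws"
  unfolding Eqs_def fv_Conj by (auto dest: set_zip_leftD set_zip_rightD)

lemma formula_in_maj_formula:
  assumes \<phi>: "formula_in L \<phi> (x @ y)"
    and zs: "zs = blocks n k z @ blocks n k z' @ blocks n k z''"
    and sorted: "sorted_like x zs" and dist: "distinct (x @ y @ concat zs)"
  shows "formula_in L (maj_formula n k \<phi> x y z z' z'') (x @ concat zs)"
proof -
  let ?p = "\<lambda>i. Alls y (Imp (Conj (map (\<lambda>j. Iff (subst \<phi> (replace x (z i j))) (Eqs (z' i j) (z'' i j))) [0..<k])) \<phi>)"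
  have zin: "z i j \<in> set zs" "z' i j \<in> set zs" "z'' i j \<in> set zs" if "i < n" "j < k" for i j
    using that by (auto simp: zs set_blocks)
  have sort: "map sort_of w = map sort_of x" if "w \<in> set zs" for w
    using sorted that by (simp add: sorted_like_def)
  have w\<phi>: "wff L \<phi>" and f\<phi>: "fv \<phi> \<subseteq> set x \<union> set y" using \<phi> by (auto simp: formula_in_def)
  have sub: "wff L (subst \<phi> (replace x (z i j)))" "fv (subst \<phi> (replace x (z i j))) \<subseteq> set (concat zs) \<union> set y"
    if ij: "i < n" "j < k" for i j
  proof -
    show "wff L (subst \<phi> (replace x (z i j)))"
      using w\<phi> sort_replace[OF sort[OF zin(1)[OF ij]]] by (simp add: wff_subst)
    have len: "length (z i j) = length x" using sort[OF zin(1)[OF ij]] by (rule map_eq_imp_length_eq)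
    have "replace x (z i j) v \<in> set (concat zs) \<union> set y" if "v \<in> fv \<phi>" for v
    proof (cases "v \<in> set x")
      case True
      then show ?thesis using replace_in[OF True len] zin(1)[OF ij] by auto
    next
      case False
      then show ?thesis using f\<phi> that by (auto simp: replace_other)
    qed
    then show "fv (subst \<phi> (replace x (z i j))) \<subseteq> set (concat zs) \<union> set y" using fv_subst by fastforce
  qed
  have eqs: "wff L (Eqs (z' i j) (z'' i j))" "fv (Eqs (z' i j) (z'' i j)) \<subseteq> set (concat zs)"
    if ij: "i < n" "j < k" for i j
  proof -
    show "wff L (Eqs (z' i j) (z'' i j))" using sort zin[OF ij] by (intro wff_Eqs) simp
    show "fv (Eqs (z' i j) (z'' i j)) \<subseteq> set (concat zs)"
      using fv_Eqs[of "z' i j" "z'' i j"] zin[OF ij] by auto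
  qed
  have "wff L (?p i)" if "i < n" for i
    using sub(1)[OF that] eqs(1)[OF that] w\<phi> by (simp add: wff_Alls wff_Conj)
  then have "wff L (maj_formula n k \<phi> x y z z' z'')"
    unfolding maj_formula_def by (intro wff_Maj) auto
  moreover have "fv (maj_formula n k \<phi> x y z z' z'') \<subseteq> set (x @ concat zs)"
    unfolding maj_formula_def
  proof (intro order_trans[OF fv_Maj] UN_least)
    fix p assume "p \<in> set (map ?p [0..<n])"
    then obtain i where i: "i < n" "p = ?p i" by auto
    show "fv p \<subseteq> set (x @ concat zs)"
      using sub(2)[OF i(1)] eqs(2)[OF i(1)] f\<phi> unfolding i(2) by (fastforce simp: fv_Alls fv_Conj)
  qed
  ultimately show ?thesis using dist by (auto simp: formula_in_def)
qed

section \<open>Supply of fresh variables\<close>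

lemma finite_vars: "finite (vars p)"
proof -
  have "finite (tm_vars t)" for t :: "('a, 'b) tm" by (induction t) auto
  then show ?thesis by (induction p) auto
qed

lemma upt_append: "i \<le> j \<Longrightarrow> j \<le> k \<Longrightarrow> [i..<j] @ [j..<k] = [i..<k]"
  using upt_add_eq_append[of i j "k - j"] by simp

text \<open>The explicit formula presupposes fresh variables, and this shows that they exist. A
  variable is a sort with a number; numbers above all those in \<phi>, \<open>x\<close> and
  \<open>y\<close> are fresh whatever the sorts, and different numbers give different
  variables.\<close>

lemma ex_fresh_blocks:
  fixes \<phi> :: "('f, 'r, 's var) fm"
  assumes "distinct (x @ y)"
  obtains z z' z'' where "sorted_like x (blocks n k z @ blocks n k z' @ blocks n k z'')"
    "distinct (x @ y @ concat (blocks n k z @ blocks n k z' @ blocks n k z''))"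
    "set (concat (blocks n k z @ blocks n k z' @ blocks n k z'')) \<inter> vars \<phi> = {}"
proof -
  let ?V = "vars \<phi> \<union> set x \<union> set y" and ?l = "length x"
  have "finite (snd ` ?V)" using finite_vars by blast
  then obtain m where m: "\<And>v. v \<in> ?V \<Longrightarrow> snd v < m"
    by (metis finite_nat_set_iff_bounded image_eqI)
  \<comment> \<open>Tuple number \<open>p\<close> occupies \<open>length x\<close> consecutive
    numbers, so a run of tuples fills an interval.\<close>
  define w where "w p = map (\<lambda>l. (sort_of (x ! l), m + p * ?l + l)) [0..<?l]" for p
  have snd_w: "map snd (w p) = [m + p * ?l..<m + Suc p * ?l]" for p
    unfolding w_def by (rule nth_equalityI) auto
  have snd_ws: "map snd (concat (map w [0..<P])) = [m..<m + P * ?l]" for P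
  proof (induction P)
    case (Suc P)
    have "[m..<m + P * ?l] @ [m + P * ?l..<m + Suc P * ?l] = [m..<m + Suc P * ?l]"
      by (rule upt_append) auto
    then show ?case using Suc by (simp add: snd_w)
  qed simp
  define B where "B off = blocks n k (\<lambda>i j. w (off + i * k + j))" for off
  have B: "B off = map w [off..<off + n * k]" for off
    unfolding B_def
  proof (induction n)
    case (Suc n)
    have "map (\<lambda>j. w (off + n * k + j)) [0..<k] = map w [off + n * k..<off + Suc n * k]"
      by (rule nth_equalityI) auto
    moreover have "[off..<off + n * k] @ [off + n * k..<off + Suc n * k] = [off..<off + Suc n * k]"
      by (rule upt_append) auto
    then have "map w [off..<off + Suc n * k] = map w [off..<off + n * k] @ map w [off + n * k..<off + Suc n * k]"
      by (metis map_append)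
    ultimately show ?case using Suc by (simp add: blocks_def)
  qed (simp add: blocks_def)
  have zs: "B 0 @ B (n * k) @ B (2 * (n * k)) = map w [0..<3 * (n * k)]"
  proof -
    have "[0..<0 + q] @ [q..<q + q] @ [2 * q..<2 * q + q] = [0..<3 * q]" for q :: nat
    proof -
      have "2 * q + q = 3 * q" by simp
      then show ?thesis
        using upt_append[of q "q + q" "3 * q"] upt_append[of 0 q "3 * q"] by (simp only: mult_2 add_0)
    qed
    then show ?thesis unfolding B map_append[symmetric] by (simp only:)
  qed
  have "distinct (map snd (concat (map w [0..<3 * (n * k)])))" unfolding snd_ws by simp
  then have 1: "distinct (concat (map w [0..<3 * (n * k)]))" by (simp only: distinct_map)
  have "snd v \<ge> m" if "v \<in> set (concat (map w [0..<3 * (n * k)]))" for v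
    using imageI[OF that, of snd] unfolding set_map[symmetric] snd_ws by simp
  then have 2: "set (concat (map w [0..<3 * (n * k)])) \<inter> ?V = {}" using m by fastforce
  have 3: "sorted_like x (map w [0..<3 * (n * k)])"
    by (auto simp: sorted_like_def w_def intro!: nth_equalityI)
  show ?thesis
    using 1 2 3 assms that[of "\<lambda>i j. w (0 + i * k + j)" "\<lambda>i j. w (n * k + i * k + j)" "\<lambda>i j. w (2 * (n * k) + i * k + j)"]
    unfolding B_def[symmetric] zs by (auto simp del: set_concat)
qed

section \<open>Honest definitions\<close>

lemma vc_below_of_vc:
  assumes "vc M \<phi> x y = enat d" and A: "A \<subseteq> tuples M x"
  shows "vc_below (\<lambda>a c. holds M \<phi> (x @ y) (a @ c)) A (Suc d) (principal (tuples M y))"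
  unfolding vc_below_principal
proof (intro allI impI, elim conjE)
  fix Z assume Z: "Z \<subseteq> A" "finite Z" "card Z = Suc d"
  let ?F = "(\<lambda>b. trace M \<phi> x y (tuples M x) b) ` tuples M y"
  have ZM: "Z \<subseteq> tuples M x" using Z(1) A by blast
  have "\<not> shatters ?F Z"
  proof
    assume "shatters ?F Z"
    then have "enat (card Z) \<le> vc M \<phi> x y"
      unfolding vc_def vc_dim_def using ZM Z(2) by (intro SUP_upper) simp
    then show False using assms(1) Z(3) by simp
  qed
  moreover have "(\<lambda>F. F \<inter> Z) ` ?F \<subseteq> Pow Z" by auto
  ultimately obtain T where T: "T \<in> Pow Z" "T \<notin> (\<lambda>F. F \<inter> Z) ` ?F"
    unfolding shatters_def by blast
  have "\<not> agree (\<lambda>a c. holds M \<phi> (x @ y) (a @ c)) (\<lambda>a. a \<in> T) Z c" if "c \<in> tuples M y" for c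
  proof
    assume "agree (\<lambda>a c. holds M \<phi> (x @ y) (a @ c)) (\<lambda>a. a \<in> T) Z c"
    then have "T = trace M \<phi> x y (tuples M x) c \<inter> Z"
      using ZM T(1) unfolding agree_def trace_def by blast
    then show False using T(2) that by blast
  qed
  then show "\<exists>T\<subseteq>Z. \<forall>c\<in>tuples M y. \<not> agree (\<lambda>a c. holds M \<phi> (x @ y) (a @ c)) (\<lambda>a. a \<in> T) Z c"
    using T(1) by blast
qed

text \<open>The formula has exactly \<open>k\<close> slots, so a smaller \<open>Y\<close> is padded
  by repeating \<open>a\<close>.\<close>

lemma ex_covering_sequence:
  assumes "finite Y" "Y \<subseteq> A" "card Y \<le> k" "a \<in> A"
  shows "\<exists>f :: nat \<Rightarrow> 'a. Y \<subseteq> f ` {..<k} \<and> (\<forall>j. f j \<in> A)"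
proof -
  obtain xs where xs: "set xs = Y" "distinct xs" using finite_distinct_list[OF assms(1)] by blast
  have len: "length xs \<le> k" using distinct_card[OF xs(2)] xs(1) assms(3) by simp
  let ?f = "\<lambda>j. if j < length xs then xs ! j else a"
  have "Y \<subseteq> ?f ` {..<k}"
  proof
    fix v assume "v \<in> Y"
    then obtain j where "j < length xs" "xs ! j = v" using xs(1) by (metis in_set_conv_nth)
    then show "v \<in> ?f ` {..<k}" using len by (intro image_eqI[of _ _ j]) auto
  qed
  moreover have "?f j \<in> A" for j using assms(2,4) xs(1) nth_mem[of j xs] by auto
  ultimately show ?thesis by blast
qed

text \<open>Each member of the majority implies its type \<open>P i\<close> on \<open>A\<close> and
  is equivalent to it on \<open>A\<^sub>0\<close>. With \<open>n = 2 * q - 1\<close>, at most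
  \<open>q - 1\<close> types err at a point: too few for a majority, and the remaining ones, at
  least \<open>q\<close>, form one. This gives the two inclusions.\<close>

lemma uniform_honest_maj_formula:
  assumes \<phi>: "formula_in L \<phi> (x @ y)" and vc: "vc M \<phi> x y = enat d"
    and pq: "pq_function N" and q: "q = 2 ^ Suc d" and n: "n = 2 * q - 1"
    and k: "k = k_sd (N n q) d"
    and zs: "zs = blocks n k z @ blocks n k z' @ blocks n k z''"
    and sorted: "sorted_like x zs" and dist: "distinct (x @ y @ concat zs)"
    and fresh: "set (concat zs) \<inter> vars \<phi> = {}"
  shows "uniform_honest_definition L M \<phi> x y (maj_formula n k \<phi> x y z z' z'') zs"
  unfolding uniform_honest_definition_def honest_definition_def
proof (intro conjI allI impI sorted)
  show "formula_in L (maj_formula n k \<phi> x y z z' z'') (x @ concat zs)"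
    by (rule formula_in_maj_formula[OF \<phi> zs sorted dist])
next
  fix A b A\<^sub>0
  assume Ab: "A \<subseteq> tuples M x \<and> small M A \<and> (\<exists>a\<in>A. \<exists>a'\<in>A. a \<noteq> a') \<and> b \<in> tuples M y"
    and "A\<^sub>0 \<subseteq> A \<and> finite A\<^sub>0"
  then have A: "A \<subseteq> tuples M x" and b: "b \<in> tuples M y" and A0: "A\<^sub>0 \<subseteq> A" "finite A\<^sub>0" by simp_all
  obtain a\<^sub>1 a\<^sub>2 where a12: "a\<^sub>1 \<in> A" "a\<^sub>2 \<in> A" "a\<^sub>1 \<noteq> a\<^sub>2" using Ab by blast
  define r where "r = (\<lambda>a c. holds M \<phi> (x @ y) (a @ c))"
  define B where "B = tuples M y"
  have q2: "2 \<le> q" unfolding q by simp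
  then have qn: "q \<le> n" "3 \<le> n" unfolding n by simp_all
  obtain m where m: "(N n q * m + 1) ^ d < 2 ^ m" "k_comp d + N n q * m \<le> k_sd (N n q) d"
    using k_sd_bounds[OF pq_function_ge_2[OF pq q2 qn]] by blast
  have "b \<in> B" using b by (simp add: B_def)
  then obtain P where P: "\<And>i. i < n \<Longrightarrow> compressible r A (k_comp d + N n q * m) (principal B) (P i)"
    and maj: "\<And>a. a \<in> A \<Longrightarrow> card {i. i < n \<and> P i a \<noteq> r a b} < q"
    using ex_majority[OF pq _ vc_below_of_vc[OF vc A, folded r_def B_def] q qn(1) refl m(1)] by blast
  have cons: "\<exists>c\<in>B. agree r (P i) Y c" if "i < n" "finite Y" "Y \<subseteq> A" for i Y
    using compressibleD(2)[OF P[OF that(1)] that(3,2)] by (auto simp: frequently_def eventually_principal)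
  have "\<exists>f :: nat \<Rightarrow> _. (\<forall>j. f j \<in> A) \<and> (\<forall>c\<in>B. agree r (P i) (f ` {..<k}) c \<longrightarrow> agree r (P i) A\<^sub>0 c)" if i: "i < n" for i
  proof -
    obtain Y where Y: "Y \<subseteq> A" "finite Y" "card Y \<le> k_comp d + N n q * m"
      "\<forall>c\<in>B. agree r (P i) Y c \<longrightarrow> agree r (P i) A\<^sub>0 c"
      using compressibleD(1)[OF P[OF i] A0] unfolding eventually_principal by blast
    have "card Y \<le> k" using Y(3) m(2) k by linarith
    from ex_covering_sequence[OF Y(2,1) this a12(1)] obtain f
      where f: "Y \<subseteq> f ` {..<k}" "\<forall>j. f j \<in> A" by (elim exE conjE)
    have "\<forall>c\<in>B. agree r (P i) (f ` {..<k}) c \<longrightarrow> agree r (P i) A\<^sub>0 c"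
    proof (intro ballI impI)
      fix c assume c: "c \<in> B" "agree r (P i) (f ` {..<k}) c"
      show "agree r (P i) A\<^sub>0 c" using Y(4) c(1) agree_subset[OF c(2) f(1)] by simp
    qed
    with f(2) show ?thesis by blast
  qed
  then obtain C where C: "\<And>i j. i < n \<Longrightarrow> C i j \<in> A"
    "\<And>i c. i < n \<Longrightarrow> c \<in> B \<Longrightarrow> agree r (P i) (C i ` {..<k}) c \<Longrightarrow> agree r (P i) A\<^sub>0 c"
    by metis
  \<comment> \<open>The truth values are coded with two distinct elements: \<open>z'\<close> is
    constantly \<open>a\<^sub>1\<close>, and \<open>z''\<close> equals it exactly where
    \<open>P i\<close> holds.\<close>
  define C'' where "C'' i j = (if P i (C i j) then a\<^sub>1 else a\<^sub>2)" for i j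
  define c where "c = blocks n k C @ blocks n k (\<lambda>_ _. a\<^sub>1) @ blocks n k C''"
  define G where "G i a \<longleftrightarrow> (\<forall>c\<in>B. agree r (P i) (C i ` {..<k}) c \<longrightarrow> r a c)" for i a
  have cA: "set c \<subseteq> A" using C(1) a12 by (auto simp: c_def set_blocks C''_def)
  have lenA: "length a = length x" if "a \<in> A" for a
    using A that by (auto simp: tuples_def dest: list_all2_lengthD)
  have "holds M (maj_formula n k \<phi> x y z z' z'') (x @ concat zs) (a @ concat c) \<longleftrightarrow>
      2 * card {i. i < n \<and> G i a} > n" if a: "a \<in> A" for a
  proof -
    have "(\<forall>j<k. r (C i j) c \<longleftrightarrow> a\<^sub>1 = C'' i j) \<longleftrightarrow> agree r (P i) (C i ` {..<k}) c" for i c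
      using a12(3) by (auto simp: agree_def C''_def)
    moreover have "length t = length x" if "t \<in> set c" for t using cA lenA that by blast
    ultimately show ?thesis
      using holds_maj_formula[OF \<phi> zs sorted dist fresh lenA[OF a] c_def, where M = M]
      unfolding G_def B_def[symmetric] fun_cong[OF fun_cong[OF r_def], symmetric] by simp
  qed
  then have tr: "trace M (maj_formula n k \<phi> x y z z' z'') x (concat zs) A (concat c) =
      {a\<in>A. 2 * card {i. i < n \<and> G i a} > n}"
    by (auto simp: trace_def)
  \<comment> \<open>\<open>P i\<close> is finitely consistent, so one parameter has its values at
    the chosen points and at \<open>a\<close> together; \<open>G i a\<close> is applied to this
    parameter.\<close>
  have GP: "P i a" if G: "G i a" and i: "i < n" and a: "a \<in> A" for i a
  proof -
    have sub: "insert a (C i ` {..<k}) \<subseteq> A" using C(1)[OF i] a by auto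
    have fin: "finite (insert a (C i ` {..<k}))" by simp
    from cons[OF i fin sub] obtain c where "c \<in> B" "agree r (P i) (insert a (C i ` {..<k})) c" ..
    then show ?thesis using G by (auto simp: G_def)
  qed
  have PG: "G i a" if "P i a" "i < n" "a \<in> A\<^sub>0" for i a
    using C(2)[OF that(2)] that(1,3) by (auto simp: G_def agree_def)
  have upper: "r a b" if a: "a \<in> A" "2 * card {i. i < n \<and> G i a} > n" for a
  proof (rule ccontr)
    assume "\<not> r a b"
    then have "{i. i < n \<and> G i a} \<subseteq> {i. i < n \<and> P i a \<noteq> r a b}" using GP a(1) by auto
    then have "card {i. i < n \<and> G i a} \<le> card {i. i < n \<and> P i a \<noteq> r a b}" by (intro card_mono) auto
    then show False using maj[OF a(1)] a(2) n by linarith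
  qed
  have lower: "2 * card {i. i < n \<and> G i a} > n" if a: "a \<in> A\<^sub>0" "r a b" for a
  proof -
    have "{..<n} \<subseteq> {i. i < n \<and> G i a} \<union> {i. i < n \<and> P i a \<noteq> r a b}" using PG a by auto
    then have "card {..<n} \<le> card ({i. i < n \<and> G i a} \<union> {i. i < n \<and> P i a \<noteq> r a b})"
      by (intro card_mono) auto
    also have "\<dots> \<le> card {i. i < n \<and> G i a} + card {i. i < n \<and> P i a \<noteq> r a b}" by (rule card_Un_le)
    finally have "n \<le> card {i. i < n \<and> G i a} + card {i. i < n \<and> P i a \<noteq> r a b}" by simp
    moreover have "card {i. i < n \<and> P i a \<noteq> r a b} < q" using maj a(1) A0(1) by blast
    ultimately show ?thesis using n q2 by linarith
  qed
  have "trace M \<phi> x y A\<^sub>0 b \<subseteq> {a\<in>A. 2 * card {i. i < n \<and> G i a} > n}"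
    using lower A0(1) by (auto simp: trace_def r_def)
  moreover have "{a\<in>A. 2 * card {i. i < n \<and> G i a} > n} \<subseteq> trace M \<phi> x y A b"
    using upper by (auto simp: trace_def r_def)
  moreover have "length c = length zs" by (simp add: c_def zs)
  ultimately show "\<exists>c. length c = length zs \<and> set c \<subseteq> A \<and>
      trace M \<phi> x y A\<^sub>0 b \<subseteq> trace M (maj_formula n k \<phi> x y z z' z'') x (concat zs) A (concat c) \<and>
      trace M (maj_formula n k \<phi> x y z z' z'') x (concat zs) A (concat c) \<subseteq> trace M \<phi> x y A b"
    using cA unfolding tr[symmetric] by blast
qed

theorem corollary5p23:
  fixes L :: "('f, 'r, 's) language"
    and T :: "('f, 'r, 's var) fm set"
    and U :: "('f, 'r, 's, 'u) struct"
    and \<phi> :: "('f, 'r, 's var) fm"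
    and x y :: "'s var list"
    and N\<^sub>p\<^sub>q :: "nat \<Rightarrow> nat \<Rightarrow> nat"
    and d n k :: nat
  assumes "complete_theory L T"
    and "monster_model L T U"
    and "formula_in L \<phi> (x @ y)"
    and "NIP U \<phi> x y"
    and "pq_function N\<^sub>p\<^sub>q"
    and "d = the_enat (vc U \<phi> x y)"
    and "n = (LEAST m::nat. 1 / 2 * real m > 2 ^ (d + 1) - 1)"
    and "k = k_sd (N\<^sub>p\<^sub>q n (2 ^ (d + 1))) d"
  shows "(\<exists>\<psi> z. uniform_honest_definition L U \<phi> x y \<psi> z) \<and>
    (\<forall>z z' z''. let zs = blocks n k z @ blocks n k z' @ blocks n k z'' in
       sorted_like x zs \<and> distinct (x @ y @ concat zs) \<and> set (concat zs) \<inter> vars \<phi> = {}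
       \<longrightarrow> uniform_honest_definition L U \<phi> x y (maj_formula n k \<phi> x y z z' z'') zs)"
proof -
  have vc: "vc U \<phi> x y = enat d" using assms(4,6) by (auto simp: NIP_def)
  \<comment> \<open>The strict inequality says that \<open>m\<close> exceeds the even number
    \<open>2 * 2 ^ Suc d - 2\<close>, so the least solution is the next, odd one.\<close>
  have "n = 2 * 2 ^ Suc d - 1"
    unfolding assms(7)
  proof (rule Least_equality)
    show "2 ^ (d + 1) - 1 < 1 / 2 * real (2 * 2 ^ Suc d - 1)" by (simp add: of_nat_diff)
    fix m :: nat assume "2 ^ (d + 1) - 1 < 1 / 2 * real m"
    then have "real (2 * 2 ^ Suc d) < real (m + 2)" by simp
    then show "2 * 2 ^ Suc d - 1 \<le> m" unfolding of_nat_less_iff by simp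
  qed
  note maj = uniform_honest_maj_formula[OF assms(3) vc assms(5) refl this assms(8)[unfolded Suc_eq_plus1[symmetric]] refl]
  have "distinct (x @ y)" using assms(3) by (simp add: formula_in_def)
  from ex_fresh_blocks[OF this, where \<phi> = \<phi>]
  obtain z z' z'' where "sorted_like x (blocks n k z @ blocks n k z' @ blocks n k z'')"
    "distinct (x @ y @ concat (blocks n k z @ blocks n k z' @ blocks n k z''))"
    "set (concat (blocks n k z @ blocks n k z' @ blocks n k z'')) \<inter> vars \<phi> = {}" .
  from maj[OF this] have "\<exists>\<psi> z. uniform_honest_definition L U \<phi> x y \<psi> z" by blast
  then show ?thesis using maj by (simp add: Let_def)
qed

end
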